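(* For $n\ge1$ let $$G_n=\langle a,b,c\mid R_1=[ba^{-1},a^{-1}ba],\ R_2=[ba^{-1},a^{-2}ba^2],\ c^{-1}a^n\rangle .$$ Then the sequence of marked groups $(G_n,\{a,b,c\})$ converges in $\mathcal G_3$ to $(G,\{a,b,c\})$, where $$G=\langle a,b,c\mid R_1,\ R_2,\ [c,a],\ [(a^{-j}ba^j)a^{-1},\,c^{-i}(a^{-k}ba^k)c^i]\ \text{ for all } i\ge1,\ j\ge0,\ k\ge0\rangle .$$
   Context: Here $[x,y]$ denotes the commutator, and $i,j,k$ are integers. Each $G_n$ is a copy of Thompson's group $F=\langle x_0,x_1\mid [x_1x_0^{-1},x_0^{-1}x_1x_0],[x_1x_0^{-1},x_0^{-2}x_1x_0^2]\rangle$ with $a=x_0$, $b=x_1$, $c=x_0^n$. A marked group $(G,S)$ is a group $G$ with a fixed ordered finite generating set $S$; $\mathcal G_3$ is the set of groups marked by $3$ elements, up to isomorphism of marked groups. Identifying generators of each marked group with a fixed basis of the free group $F_3$ of rank $3$, two marked groups are at distance at most $e^{-R}$ if they have the same relations (words representing the identity) of length at most $R$; convergence is with respect to this topology. Equivalently, $(\Gamma_n,S_n)\to(\Gamma,S)$ if and only if every word $w\in F_3$ trivial in $\Gamma$ is trivial in $\Gamma_n$ for all large $n$, and every $w\in F_3$ trivial in $\Gamma_n$ for infinitely many $n$ is trivial in $\Gamma$. *)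

theory Defs
  imports "HOL-Analysis.Analysis" "HOL-Algebra.Generated_Groups"
begin

section \<open>The free group on the elements of a type\<close>

text \<open>
  The letter \<open>(x, True)\<close> stands for the basis element \<open>x\<close> and \<open>(x, False)\<close> for its inverse.
  Elements of the free group are represented by their reduced words.
\<close>

type_synonym 'x word = "('x \<times> bool) list"

definition inv_letter :: "'x \<times> bool \<Rightarrow> 'x \<times> bool" where
  "inv_letter l = (fst l, \<not> snd l)"

definition reduced :: "'x word \<Rightarrow> bool" where
  "reduced w \<longleftrightarrow> successively (\<lambda>l m. m \<noteq> inv_letter l) w"

definition cancel_cons :: "'x \<times> bool \<Rightarrow> 'x word \<Rightarrow> 'x word" where
  "cancel_cons l w = (case w of [] \<Rightarrow> [l] | m # v \<Rightarrow> if m = inv_letter l then v else l # w)"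

definition reduce :: "'x word \<Rightarrow> 'x word" where
  "reduce w = foldr cancel_cons w []"

definition free_group :: "'x word monoid" where
  "free_group = \<lparr>carrier = {w. reduced w}, mult = (\<lambda>u v. reduce (u @ v)), one = []\<rparr>"

definition basis_elt :: "'x \<Rightarrow> 'x word" where
  "basis_elt x = [(x, True)]"

lemma reduced_Nil: "reduced []"
  by (simp add: reduced_def)

lemma reduced_tl: "reduced (l # w) \<Longrightarrow> reduced w"
  by (cases w) (auto simp: reduced_def)

lemma inv_letter_inv_letter [simp]: "inv_letter (inv_letter l) = l"
  by (simp add: inv_letter_def)

lemma reduced_cancel_cons: "reduced w \<Longrightarrow> reduced (cancel_cons l w)"
  by (cases w) (auto simp: reduced_def cancel_cons_def successively_Cons)

lemma reduced_foldr: "reduced w \<Longrightarrow> reduced (foldr cancel_cons u w)"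
  by (induction u) (auto simp: reduced_cancel_cons)

lemma cancel_cons_inv: "reduced w \<Longrightarrow> cancel_cons l (cancel_cons (inv_letter l) w) = w"
  by (cases w)
     (auto simp: cancel_cons_def reduced_def successively_Cons split: list.splits)

lemma cancel_cons_reduced: "reduced (l # w) \<Longrightarrow> cancel_cons l w = l # w"
  by (cases w) (auto simp: cancel_cons_def reduced_def)

lemma reduce_reduced: "reduced w \<Longrightarrow> reduce w = w"
  unfolding reduce_def
proof (induction w)
  case (Cons l w)
  then show ?case using reduced_tl cancel_cons_reduced by fastforce
qed simp

lemma foldr_cancel_cons:
  assumes "reduced w"
  shows "foldr cancel_cons (cancel_cons l v) w = cancel_cons l (foldr cancel_cons v w)"
proof (cases v)
  case (Cons m v')
  then show ?thesis
    using cancel_cons_inv[OF reduced_foldr[OF assms]]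
    by (auto simp: cancel_cons_def[of l "m # v'"])
qed (simp add: cancel_cons_def)

lemma foldr_foldr_cancel:
  assumes "reduced w"
  shows "foldr cancel_cons (foldr cancel_cons u v) w = foldr cancel_cons u (foldr cancel_cons v w)"
  by (induction u) (simp_all add: foldr_cancel_cons[OF assms])

lemma reduce_append: "reduced v \<Longrightarrow> reduce (u @ v) = foldr cancel_cons u v"
  using reduce_reduced[of v] by (simp add: reduce_def)

lemma reduced_reduce: "reduced (reduce w)"
  by (simp add: reduce_def reduced_foldr reduced_Nil)

lemma foldr_inverse:
  "reduced v \<Longrightarrow> foldr cancel_cons (rev (map inv_letter w)) (foldr cancel_cons w v) = v"
proof (induction w arbitrary: v)
  case (Cons l w)
  have "cancel_cons (inv_letter l) (cancel_cons l (foldr cancel_cons w v)) = foldr cancel_cons w v"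
    using cancel_cons_inv[of "foldr cancel_cons w v" "inv_letter l"] Cons.prems
    by (simp add: reduced_foldr)
  then show ?case using Cons by simp
qed simp

lemma group_free_group: "group free_group"
proof (rule groupI)
  fix x y z :: "'x word"
  assume x: "x \<in> carrier free_group" and y: "y \<in> carrier free_group"
    and z: "z \<in> carrier free_group"
  show "x \<otimes>\<^bsub>free_group\<^esub> y \<in> carrier free_group"
    by (simp add: free_group_def reduced_reduce)
  show "\<one>\<^bsub>free_group\<^esub> \<otimes>\<^bsub>free_group\<^esub> x = x"
    using x by (simp add: free_group_def reduce_reduced)
  show "x \<otimes>\<^bsub>free_group\<^esub> y \<otimes>\<^bsub>free_group\<^esub> z
        = x \<otimes>\<^bsub>free_group\<^esub> (y \<otimes>\<^bsub>free_group\<^esub> z)"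
    using x y z
    by (simp add: free_group_def reduce_append foldr_foldr_cancel reduced_foldr)
next
  fix x :: "'x word"
  assume x: "x \<in> carrier free_group"
  let ?y = "reduce (rev (map inv_letter x))"
  have "foldr cancel_cons (rev (map inv_letter x)) (foldr cancel_cons x []) = []"
    by (rule foldr_inverse) (rule reduced_Nil)
  moreover have "foldr cancel_cons x [] = x"
    using x reduce_reduced[of x] by (simp add: free_group_def reduce_def)
  ultimately have "?y \<otimes>\<^bsub>free_group\<^esub> x = \<one>\<^bsub>free_group\<^esub>"
    using x by (simp add: free_group_def reduce_append) (simp add: reduce_def foldr_foldr_cancel)
  then show "\<exists>y\<in>carrier free_group. y \<otimes>\<^bsub>free_group\<^esub> x = \<one>\<^bsub>free_group\<^esub>"
    using reduced_reduce by (intro bexI[of _ ?y]) (auto simp: free_group_def)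
qed (auto simp: free_group_def reduced_Nil)

lemma basis_elt_closed: "basis_elt x \<in> carrier free_group"
  by (simp add: basis_elt_def free_group_def reduced_def)


section \<open>Marked groups\<close>

text \<open>
  A group marked by \<open>k\<close> elements is a group with a generating family indexed by a \<open>k\<close>-element
  type \<open>'x\<close>.  The family need not be injective, so generators may be repeated.
\<close>

definition marked_group :: "'a monoid \<Rightarrow> ('x::finite \<Rightarrow> 'a) \<Rightarrow> bool" where
  "marked_group G S \<longleftrightarrow> group G \<and> range S \<subseteq> carrier G \<and> generate G (range S) = carrier G"

definition marked_iso ::
    "'a monoid \<Rightarrow> ('x::finite \<Rightarrow> 'a) \<Rightarrow> 'b monoid \<Rightarrow> ('x \<Rightarrow> 'b) \<Rightarrow> bool" where
  "marked_iso G S H T \<longleftrightarrow> (\<exists>\<phi>\<in>iso G H. \<forall>x. \<phi> (S x) = T x)"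

definition eval_word :: "'a monoid \<Rightarrow> ('x \<Rightarrow> 'a) \<Rightarrow> 'x word \<Rightarrow> 'a" where
  "eval_word G S w =
     foldr (\<lambda>(x, e) g. (if e then S x else inv\<^bsub>G\<^esub> (S x)) \<otimes>\<^bsub>G\<^esub> g) w \<one>\<^bsub>G\<^esub>"

definition relations :: "'a monoid \<Rightarrow> ('x \<Rightarrow> 'a) \<Rightarrow> 'x word set" where
  "relations G S = kernel free_group G (eval_word G S)"

definition same_relations ::
    "nat \<Rightarrow> 'a monoid \<Rightarrow> ('x \<Rightarrow> 'a) \<Rightarrow> 'b monoid \<Rightarrow> ('x \<Rightarrow> 'b) \<Rightarrow> bool" where
  "same_relations R G S H T \<longleftrightarrow>
     (\<forall>w\<in>carrier free_group. length w \<le> R \<longrightarrow> (w \<in> relations G S \<longleftrightarrow> w \<in> relations H T))"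

text \<open>
  Isomorphism classes are formed among the marked groups whose elements lie in a fixed type \<open>'a\<close>.
  For \<open>'a = 'x word set\<close>, where the groups given by presentations live, every group marked by
  \<open>'x\<close> occurs up to isomorphism: see \<open>marked_group_representable\<close> below.
\<close>

type_synonym ('x, 'a) marked_class = "('a monoid \<times> ('x \<Rightarrow> 'a)) set"

definition marked_class :: "'a monoid \<Rightarrow> ('x::finite \<Rightarrow> 'a) \<Rightarrow> ('x, 'a) marked_class" where
  "marked_class G S = {(H, T). marked_group H T \<and> marked_iso G S H T}"

definition marked_space :: "('x::finite, 'a) marked_class set" where
  "marked_space = {marked_class G S | G S. marked_group G S}"

text \<open>
  The distance is the least \<open>exp (- R)\<close> such that the relations of length at most \<open>R\<close> agree, and \<open>0\<close>
  if all relations agree; this is \<open>marked_dist_le_iff\<close> below.  Since the relations of length \<open>0\<close>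
  always agree, the value \<open>1 = exp (- 0)\<close> in the other case does not affect the infimum.
\<close>

definition marked_dist :: "('x::finite, 'a) marked_class \<Rightarrow> ('x, 'a) marked_class \<Rightarrow> real" where
  "marked_dist X Y =
     Inf (range (\<lambda>R. if \<forall>(G, S)\<in>X. \<forall>(H, T)\<in>Y. same_relations R G S H T
                     then exp (- real R) else 1))"

definition marked_topology :: "('x::finite, 'a) marked_class topology" where
  "marked_topology = Metric_space.mtopology marked_space marked_dist"


section \<open>Presentations\<close>

definition normal_closure :: "'a monoid \<Rightarrow> 'a set \<Rightarrow> 'a set" where
  "normal_closure G R = generate G {g \<otimes>\<^bsub>G\<^esub> r \<otimes>\<^bsub>G\<^esub> inv\<^bsub>G\<^esub> g | g r. g \<in> carrier G \<and> r \<in> R}"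

definition presentation :: "'x word set \<Rightarrow> 'x word set monoid" where
  "presentation R = free_group Mod normal_closure free_group R"

definition presentation_gen :: "'x word set \<Rightarrow> 'x \<Rightarrow> 'x word set" where
  "presentation_gen R x = normal_closure free_group R #>\<^bsub>free_group\<^esub> basis_elt x"

definition presented_class :: "'x::finite word set \<Rightarrow> ('x, 'x word set) marked_class" where
  "presented_class R = marked_class (presentation R) (presentation_gen R)"

text \<open>
  The other convention for commutators yields a conjugate element, hence the same normal closures.
\<close>

definition commutator :: "'a monoid \<Rightarrow> 'a \<Rightarrow> 'a \<Rightarrow> 'a" where
  "commutator G x y = x \<otimes>\<^bsub>G\<^esub> y \<otimes>\<^bsub>G\<^esub> inv\<^bsub>G\<^esub> x \<otimes>\<^bsub>G\<^esub> inv\<^bsub>G\<^esub> y"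

definition conj_by :: "'a monoid \<Rightarrow> 'a \<Rightarrow> 'a \<Rightarrow> 'a" where
  "conj_by G x y = inv\<^bsub>G\<^esub> x \<otimes>\<^bsub>G\<^esub> y \<otimes>\<^bsub>G\<^esub> x"


section \<open>The presentations over three generators\<close>

datatype gen3 = Gen_a | Gen_b | Gen_c

instance gen3 :: finite
proof
  have "(UNIV :: gen3 set) = {Gen_a, Gen_b, Gen_c}"
    using gen3.exhaust by auto
  then show "finite (UNIV :: gen3 set)"
    by (metis finite.emptyI finite.insertI)
qed

abbreviation F3 :: "gen3 word monoid" where
  "F3 \<equiv> free_group"

abbreviation wa :: "gen3 word" where "wa \<equiv> basis_elt Gen_a"
abbreviation wb :: "gen3 word" where "wb \<equiv> basis_elt Gen_b"
abbreviation wc :: "gen3 word" where "wc \<equiv> basis_elt Gen_c"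

definition R1 :: "gen3 word" where
  "R1 = commutator F3 (wb \<otimes>\<^bsub>F3\<^esub> inv\<^bsub>F3\<^esub> wa) (conj_by F3 wa wb)"

definition R2 :: "gen3 word" where
  "R2 = commutator F3 (wb \<otimes>\<^bsub>F3\<^esub> inv\<^bsub>F3\<^esub> wa) (conj_by F3 (wa [^]\<^bsub>F3\<^esub> (2::nat)) wb)"

definition relators_G_seq :: "nat \<Rightarrow> gen3 word set" where
  "relators_G_seq n = {R1, R2, inv\<^bsub>F3\<^esub> wc \<otimes>\<^bsub>F3\<^esub> wa [^]\<^bsub>F3\<^esub> n}"

definition relators_G :: "gen3 word set" where
  "relators_G = {R1, R2, commutator F3 wc wa} \<union>
     {commutator F3
        (conj_by F3 (wa [^]\<^bsub>F3\<^esub> j) wb \<otimes>\<^bsub>F3\<^esub> inv\<^bsub>F3\<^esub> wa)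
        (conj_by F3 (wc [^]\<^bsub>F3\<^esub> i) (conj_by F3 (wa [^]\<^bsub>F3\<^esub> k) wb))
      | (i::nat) (j::nat) (k::nat). 1 \<le> i}"


section \<open>Well-formedness\<close>

lemma normal_normal_closure:
  assumes "group G" "R \<subseteq> carrier G"
  shows "normal_closure G R \<lhd> G"
proof -
  interpret group G by fact
  show ?thesis
    unfolding normal_closure_def
  proof (rule normal_generateI)
    let ?C = "{g \<otimes>\<^bsub>G\<^esub> r \<otimes>\<^bsub>G\<^esub> inv\<^bsub>G\<^esub> g | g r. g \<in> carrier G \<and> r \<in> R}"
    fix h g
    assume "h \<in> ?C" and g: "g \<in> carrier G"
    then obtain k r where h: "h = k \<otimes>\<^bsub>G\<^esub> r \<otimes>\<^bsub>G\<^esub> inv\<^bsub>G\<^esub> k" "k \<in> carrier G" "r \<in> R"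
      by blast
    then have "r \<in> carrier G" using assms by blast
    then have "g \<otimes>\<^bsub>G\<^esub> h \<otimes>\<^bsub>G\<^esub> inv\<^bsub>G\<^esub> g
        = (g \<otimes>\<^bsub>G\<^esub> k) \<otimes>\<^bsub>G\<^esub> r \<otimes>\<^bsub>G\<^esub> inv\<^bsub>G\<^esub> (g \<otimes>\<^bsub>G\<^esub> k)"
      using h g by (simp add: m_assoc inv_mult_group)
    then show "g \<otimes>\<^bsub>G\<^esub> h \<otimes>\<^bsub>G\<^esub> inv\<^bsub>G\<^esub> g \<in> ?C"
      using h g by blast
  qed (use assms in auto)
qed

context
  fixes G :: "'a monoid" and S :: "'x \<Rightarrow> 'a"
  assumes G: "group G" and S: "range S \<subseteq> carrier G"
begin

interpretation group G by (rule G)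

lemma eval_word_closed: "eval_word G S w \<in> carrier G"
proof (induction w)
  case (Cons l w)
  then show ?case using S by (cases l) (auto simp: eval_word_def)
qed (simp add: eval_word_def)

lemma eval_word_cancel_cons: "eval_word G S (cancel_cons l w) = eval_word G S (l # w)"
proof (cases "\<exists>v. w = inv_letter l # v")
  case True
  then obtain v where v: "w = inv_letter l # v" by blast
  obtain x e where l: "l = (x, e)" by (cases l)
  have "S x \<in> carrier G" using S by auto
  moreover have "eval_word G S v \<in> carrier G" by (rule eval_word_closed)
  ultimately show ?thesis
    unfolding v l cancel_cons_def eval_word_def inv_letter_def
    by (auto simp: m_assoc[symmetric])
next
  case False
  then have "cancel_cons l w = l # w" by (cases w) (auto simp: cancel_cons_def)
  then show ?thesis by simp
qed

lemma eval_word_foldr: 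
  "eval_word G S (foldr cancel_cons u v) = eval_word G S u \<otimes>\<^bsub>G\<^esub> eval_word G S v"
proof (induction u)
  case Nil
  then show ?case using eval_word_closed[of v] by (simp add: eval_word_def)
next
  case (Cons l u)
  obtain x e where l: "l = (x, e)" by (cases l)
  have *: "eval_word G S (l # w) = (if e then S x else inv\<^bsub>G\<^esub> (S x)) \<otimes>\<^bsub>G\<^esub> eval_word G S w" for w
    by (simp add: eval_word_def l)
  have "S x \<in> carrier G" using S by auto
  then show ?case
    using Cons eval_word_closed by (auto simp: eval_word_cancel_cons * m_assoc)
qed

lemma group_hom_eval_word: "group_hom free_group G (eval_word G S)"
  unfolding group_hom_def group_hom_axioms_def
  by (auto simp: group_free_group G hom_def eval_word_closed)
     (simp add: free_group_def reduce_append eval_word_foldr)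

lemma eval_word_basis_elt: "eval_word G S (basis_elt x) = S x"
proof -
  have "S x \<in> carrier G" using S by auto
  then show ?thesis by (simp add: eval_word_def basis_elt_def)
qed

lemma eval_word_surj:
  assumes "generate G (range S) = carrier G"
  shows "eval_word G S ` carrier free_group = carrier G"
proof -
  interpret h: group_hom free_group G "eval_word G S" by (rule group_hom_eval_word)
  have "range S \<subseteq> eval_word G S ` carrier free_group"
    using eval_word_basis_elt basis_elt_closed by (metis image_subset_iff rev_image_eqI)
  then have "generate G (range S) \<subseteq> eval_word G S ` carrier free_group"
    by (rule generate_subgroup_incl) (rule h.img_is_subgroup)
  then show ?thesis using assms eval_word_closed by blast
qed

end

lemma generate_hom_image:
  assumes "group_hom G H h" "K \<subseteq> carrier G"
  shows "generate H (h ` K) = h ` generate G K"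
  using group_hom.generate_img[OF assms] by simp

lemma generate_free_group: "generate free_group (range basis_elt) = carrier free_group"
proof -
  interpret group free_group by (rule group_free_group)
  have gen: "range basis_elt \<subseteq> carrier free_group" using basis_elt_closed by auto
  have "w \<in> generate free_group (range basis_elt)" if "reduced w" for w :: "'x word"
    using that
  proof (induction w)
    case Nil
    show ?case using generate.one[of free_group] by (simp add: free_group_def)
  next
    case (Cons l w)
    obtain x e where l: "l = (x, e)" by (cases l)
    have *: "[l] \<in> generate free_group (range basis_elt)"
    proof (cases e)
      case True
      then show ?thesis using l by (auto intro: generate.incl simp: basis_elt_def)
    next
      case False
      have "[l] \<otimes>\<^bsub>free_group\<^esub> basis_elt x = \<one>\<^bsub>free_group\<^esub>"
        using False l
        by (simp add: free_group_def basis_elt_def reduce_def cancel_cons_def inv_letter_def)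
      moreover have "[l] \<in> carrier free_group" by (simp add: free_group_def reduced_def)
      ultimately have "inv\<^bsub>free_group\<^esub> basis_elt x = [l]"
        by (intro inv_equality basis_elt_closed)
      then show ?thesis
        using generate.inv[of "basis_elt x" "range basis_elt" free_group] by simp
    qed
    have "[l] \<otimes>\<^bsub>free_group\<^esub> w = l # w"
      using reduce_reduced[OF Cons.prems] by (simp add: free_group_def)
    then show ?case
      using generate.eng[OF * Cons.IH] reduced_tl[OF Cons.prems] by simp
  qed
  then show ?thesis
    using generate_incl[OF gen] by (auto simp: free_group_def)
qed

lemma marked_group_quotient:
  fixes N :: "'x::finite word set"
  assumes "N \<lhd> free_group"
  shows "marked_group (free_group Mod N) (\<lambda>x. N #>\<^bsub>free_group\<^esub> basis_elt x)"
proof -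
  interpret normal N free_group by fact
  have hom: "group_hom free_group (free_group Mod N) (\<lambda>g. N #>\<^bsub>free_group\<^esub> g)"
    using factorgroup_is_group r_coset_hom_Mod group_free_group
    by (simp add: group_hom_def group_hom_axioms_def)
  have sub: "range basis_elt \<subseteq> carrier (free_group :: 'x word monoid)"
    using basis_elt_closed by auto
  have "generate (free_group Mod N) ((\<lambda>g. N #>\<^bsub>free_group\<^esub> g) ` range basis_elt)
        = (\<lambda>g. N #>\<^bsub>free_group\<^esub> g) ` carrier free_group"
    using generate_hom_image[OF hom sub] by (simp add: generate_free_group)
  also have "\<dots> = carrier (free_group Mod N)"
    by (auto simp: FactGroup_def RCOSETS_def)
  finally show ?thesis
    using factorgroup_is_group sub
    by (auto simp: marked_group_def image_image FactGroup_def RCOSETS_def)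
qed

lemma marked_group_presentation:
  fixes R :: "'x::finite word set"
  assumes "R \<subseteq> carrier free_group"
  shows "marked_group (presentation R) (presentation_gen R)"
  using marked_group_quotient[OF normal_normal_closure[OF group_free_group assms]]
  by (simp add: presentation_def presentation_gen_def[abs_def])

lemma marked_iso_quotient:
  assumes "marked_group G S"
  shows "relations G S \<lhd> free_group"
    and "marked_iso (free_group Mod relations G S)
           (\<lambda>x. relations G S #>\<^bsub>free_group\<^esub> basis_elt x) G S"
proof -
  have GS: "group G" "range S \<subseteq> carrier G" using assms by (auto simp: marked_group_def)
  interpret h: group_hom free_group G "eval_word G S" by (rule group_hom_eval_word[OF GS])
  show N: "relations G S \<lhd> free_group"
    unfolding relations_def by (rule h.normal_kernel)
  have "(\<lambda>X. the_elem (eval_word G S ` X)) \<in> iso (free_group Mod relations G S) G"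
    unfolding relations_def
    by (rule h.FactGroup_iso_set, rule eval_word_surj[OF GS])
       (use assms in \<open>simp add: marked_group_def\<close>)
  moreover have "the_elem (eval_word G S ` (relations G S #>\<^bsub>free_group\<^esub> basis_elt x)) = S x" for x
  proof -
    have Sx: "S x \<in> carrier G" using GS by auto
    have "eval_word G S ` (relations G S #>\<^bsub>free_group\<^esub> basis_elt x) = {S x}"
    proof -
      have "eval_word G S (k \<otimes>\<^bsub>free_group\<^esub> basis_elt x) = S x" if "k \<in> relations G S" for k
        using that basis_elt_closed[of x] eval_word_basis_elt[OF GS, of x] Sx
        by (auto simp: relations_def kernel_def)
      moreover have "\<one>\<^bsub>free_group\<^esub> \<in> relations G S"
        by (simp add: relations_def kernel_def)
      ultimately show ?thesis by (force simp: r_coset_def)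
    qed
    then show ?thesis by simp
  qed
  ultimately show "marked_iso (free_group Mod relations G S)
           (\<lambda>x. relations G S #>\<^bsub>free_group\<^esub> basis_elt x) G S"
    unfolding marked_iso_def
    by (intro bexI[of _ "\<lambda>X. the_elem (eval_word G S ` X)"] allI)
qed

lemma marked_iso_refl: "marked_group G S \<Longrightarrow> marked_iso G S G S"
  unfolding marked_iso_def by (intro bexI[of _ "\<lambda>x. x"]) (auto simp: iso_set_refl)

lemma marked_iso_sym:
  assumes "marked_group G S" "marked_iso G S H T"
  shows "marked_iso H T G S"
proof -
  obtain \<phi> where \<phi>: "\<phi> \<in> iso G H" "\<And>x. \<phi> (S x) = T x"
    using assms by (auto simp: marked_iso_def)
  have "inv_into (carrier G) \<phi> \<in> iso H G"
    using assms \<phi> group.iso_set_sym by (auto simp: marked_group_def)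
  moreover have "inv_into (carrier G) \<phi> (T x) = S x" for x
    unfolding \<phi>(2)[symmetric]
    by (rule inv_into_f_f) (use assms \<phi> in \<open>auto simp: iso_def bij_betw_def marked_group_def\<close>)
  ultimately show ?thesis unfolding marked_iso_def by blast
qed

lemma marked_iso_trans:
  assumes "marked_iso G S H T" "marked_iso H T K U"
  shows "marked_iso G S K U"
proof -
  obtain \<phi> \<psi> where "\<phi> \<in> iso G H" "\<And>x. \<phi> (S x) = T x" "\<psi> \<in> iso H K" "\<And>x. \<psi> (T x) = U x"
    using assms by (auto simp: marked_iso_def)
  then show ?thesis
    unfolding marked_iso_def by (intro bexI[of _ "\<psi> \<circ> \<phi>"]) (auto intro: iso_set_trans)
qed

lemma marked_group_representable:
  fixes S :: "'x::finite \<Rightarrow> 'a"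
  assumes "marked_group G S"
  shows "\<exists>(H :: 'x word set monoid) T. marked_group H T \<and> marked_iso H T G S"
  using marked_iso_quotient[OF assms] marked_group_quotient by blast

lemma relations_marked_iso:
  assumes "marked_group G S" "marked_group H T" "marked_iso G S H T"
  shows "relations G S = relations H T"
proof -
  obtain \<phi> where \<phi>: "\<phi> \<in> iso G H" "\<And>x. \<phi> (S x) = T x"
    using assms by (auto simp: marked_iso_def)
  have GS: "group G" "range S \<subseteq> carrier G" and HT: "group H" "range T \<subseteq> carrier H"
    using assms by (auto simp: marked_group_def)
  interpret \<phi>: group_hom G H \<phi>
    using \<phi> GS HT by (auto simp: group_hom_def group_hom_axioms_def iso_def)
  have eval: "eval_word H T w = \<phi> (eval_word G S w)" for w
  proof (induction w)
    case (Cons l w)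
    obtain x e where l: "l = (x, e)" by (cases l)
    have "S x \<in> carrier G" using GS by auto
    then show ?case
      using Cons eval_word_closed[OF GS, of w] by (auto simp: eval_word_def l \<phi>(2))
  qed (simp add: eval_word_def)
  have "inj_on \<phi> (carrier G)" using \<phi> by (auto simp: iso_def bij_betw_def)
  then have "\<phi> g = \<one>\<^bsub>H\<^esub> \<longleftrightarrow> g = \<one>\<^bsub>G\<^esub>" if "g \<in> carrier G" for g
    using that \<phi>.hom_one by (metis \<phi>.G.one_closed inj_onD)
  then show ?thesis
    using eval_word_closed[OF GS] by (auto simp: relations_def kernel_def eval)
qed

lemma marked_iso_iff_relations:
  assumes "marked_group G S" "marked_group H T"
  shows "marked_iso G S H T \<longleftrightarrow> relations G S = relations H T"
proof
  assume eq: "relations G S = relations H T"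
  have "marked_iso G S (free_group Mod relations G S)
          (\<lambda>x. relations G S #>\<^bsub>free_group\<^esub> basis_elt x)"
    using marked_iso_quotient[OF assms(1)] marked_group_quotient marked_iso_sym by blast
  then show "marked_iso G S H T"
    using marked_iso_quotient(2)[OF assms(2)] marked_iso_trans eq by metis
qed (rule relations_marked_iso[OF assms])

lemma same_relations_classes:
  assumes "marked_group G S" "marked_group H T"
  shows "(\<forall>(G', S')\<in>marked_class G S. \<forall>(H', T')\<in>marked_class H T. same_relations R G' S' H' T')
         \<longleftrightarrow> same_relations R G S H T"
proof -
  have "relations G' S' = relations G S" if "(G', S') \<in> marked_class G S" for G' S'
    using that relations_marked_iso[OF assms(1)] by (auto simp: marked_class_def)
  moreover have "relations H' T' = relations H T" if "(H', T') \<in> marked_class H T" for H' T'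
    using that relations_marked_iso[OF assms(2)] by (auto simp: marked_class_def)
  moreover have "(G, S) \<in> marked_class G S" "(H, T) \<in> marked_class H T"
    using assms marked_iso_refl by (auto simp: marked_class_def)
  ultimately show ?thesis
    unfolding same_relations_def Ball_def[of "marked_class G S"] Ball_def[of "marked_class H T"]
      split_paired_All case_prod_conv
    by metis
qed

lemma same_relations_mono: "same_relations R G S H T \<Longrightarrow> Q \<le> R \<Longrightarrow> same_relations Q G S H T"
  by (auto simp: same_relations_def)

lemma same_relations_0:
  assumes "marked_group G S" "marked_group H T"
  shows "same_relations 0 G S H T"
  using assms
  by (auto simp: same_relations_def relations_def kernel_def eval_word_def)

lemma marked_dist_bdd:
  "bdd_below (range (\<lambda>R. if P R then exp (- real R) else 1))"
  by (rule bdd_belowI[of _ 0]) auto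

lemma marked_dist_nonneg: "0 \<le> marked_dist X Y"
  unfolding marked_dist_def by (rule cINF_greatest) auto

lemma marked_dist_le_iff:
  assumes "marked_group G S" "marked_group H T"
  shows "marked_dist (marked_class G S) (marked_class H T) \<le> exp (- real R)
         \<longleftrightarrow> same_relations R G S H T"
proof
  assume "same_relations R G S H T"
  then show "marked_dist (marked_class G S) (marked_class H T) \<le> exp (- real R)"
    unfolding marked_dist_def same_relations_classes[OF assms]
    by (intro cINF_lower2[OF marked_dist_bdd, of R]) auto
next
  assume le: "marked_dist (marked_class G S) (marked_class H T) \<le> exp (- real R)"
  show "same_relations R G S H T"
  proof (rule ccontr)
    assume neg: "\<not> same_relations R G S H T"
    then have pos: "R > 0" using same_relations_0[OF assms] by (cases R) auto
    have "exp (- real (R - 1)) \<le> marked_dist (marked_class G S) (marked_class H T)"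
      unfolding marked_dist_def same_relations_classes[OF assms]
    proof (rule cINF_greatest)
      fix Q
      show "exp (- real (R - 1)) \<le> (if same_relations Q G S H T then exp (- real Q) else 1)"
      proof (cases "same_relations Q G S H T")
        case True
        then have "Q < R" using neg same_relations_mono[of Q G S H T R] by (meson not_le)
        then show ?thesis using True by simp
      qed (use pos in simp)
    qed simp
    moreover have "exp (- real R) < exp (- real (R - 1))" using pos by simp
    ultimately show False using le by linarith
  qed
qed

lemma marked_class_eq_iff:
  fixes G H :: "'b monoid"
  assumes "marked_group G S" "marked_group H T"
  shows "marked_class G S = marked_class H T \<longleftrightarrow> marked_iso G S H T"
proof
  assume "marked_class G S = marked_class H T"
  then have "(H, T) \<in> marked_class G S"
    using assms marked_iso_refl by (auto simp: marked_class_def)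
  then show "marked_iso G S H T" by (simp add: marked_class_def)
next
  assume "marked_iso G S H T"
  then have "marked_iso G S K U \<longleftrightarrow> marked_iso H T K U" for K :: "'b monoid" and U
    using marked_iso_sym[OF assms(1)] marked_iso_trans by metis
  then show "marked_class G S = marked_class H T" by (simp add: marked_class_def)
qed

lemma marked_dist_eq_0_iff:
  assumes "marked_group G S" "marked_group H T"
  shows "marked_dist (marked_class G S) (marked_class H T) = 0 \<longleftrightarrow> relations G S = relations H T"
proof
  assume "marked_dist (marked_class G S) (marked_class H T) = 0"
  then have "same_relations R G S H T" for R using marked_dist_le_iff[OF assms, of R] by simp
  moreover have "relations G S \<subseteq> carrier free_group" "relations H T \<subseteq> carrier free_group"
    by (auto simp: relations_def kernel_def)
  ultimately show "relations G S = relations H T"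
    unfolding same_relations_def by blast
next
  let ?d = "marked_dist (marked_class G S) (marked_class H T)"
  assume "relations G S = relations H T"
  then have le: "?d \<le> exp (- real R)" for R
    using marked_dist_le_iff[OF assms, of R] by (simp add: same_relations_def)
  have "(\<lambda>R. exp (- real R)) \<longlonglongrightarrow> 0"
    by (rule filterlim_compose[OF exp_at_bot])
       (simp add: filterlim_uminus_at_top[symmetric] filterlim_real_sequentially)
  then have "?d \<le> 0" using le LIMSEQ_le_const by blast
  then show "?d = 0" using marked_dist_nonneg order_antisym by blast
qed

lemma marked_dist_ultrametric:
  fixes G H K :: "'a monoid" and S T U :: "'x::finite \<Rightarrow> 'a"
  assumes "marked_group G S" "marked_group H T" "marked_group K U"
  shows "marked_dist (marked_class G S) (marked_class K U)
         \<le> max (marked_dist (marked_class G S) (marked_class H T))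
               (marked_dist (marked_class H T) (marked_class K U))"
    (is "?gk \<le> max ?gh ?hk")
proof (rule ccontr)
  assume "\<not> ?thesis"
  then have gh: "?gh < ?gk" and hk: "?hk < ?gk" by auto
  have ex: "\<exists>Q. same_relations Q A V B W \<and> exp (- real Q) < ?gk"
    if "marked_dist (marked_class A V) (marked_class B W) < ?gk"
      and AB: "marked_group A V" "marked_group B W"
    for A B :: "'a monoid" and V W :: "'x \<Rightarrow> 'a"
  proof -
    have "?gk \<le> 1"
      using marked_dist_le_iff[OF assms(1,3), of 0] same_relations_0[OF assms(1,3)] by simp
    moreover have "\<exists>Q. (if same_relations Q A V B W then exp (- real Q) else 1) < ?gk"
      using that(1)
      unfolding marked_dist_def[of "marked_class A V"] same_relations_classes[OF AB]
      by (subst (asm) cINF_less_iff[OF _ marked_dist_bdd]) auto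
    ultimately show ?thesis by (force split: if_splits)
  qed
  obtain Q1 where Q1: "same_relations Q1 G S H T" "exp (- real Q1) < ?gk"
    using ex[OF gh assms(1,2)] by blast
  obtain Q2 where Q2: "same_relations Q2 H T K U" "exp (- real Q2) < ?gk"
    using ex[OF hk assms(2,3)] by blast
  have "same_relations (min Q1 Q2) G S K U"
    using Q1 Q2 by (auto simp: same_relations_def)
  then have "?gk \<le> exp (- real (min Q1 Q2))"
    using marked_dist_le_iff[OF assms(1,3)] by blast
  then show False using Q1(2) Q2(2) by (auto simp: min_def split: if_splits)
qed

lemma Metric_space_marked: "Metric_space marked_space marked_dist"
proof
  fix X Y :: "('x::finite, 'a) marked_class"
  show "0 \<le> marked_dist X Y" by (rule marked_dist_nonneg)
  have "(\<forall>(G, S)\<in>X. \<forall>(H, T)\<in>Y. same_relations R G S H T)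
      = (\<forall>(G, S)\<in>Y. \<forall>(H, T)\<in>X. same_relations R G S H T)" for R
    unfolding same_relations_def by (simp add: split_def) metis
  then show "marked_dist X Y = marked_dist Y X"
    unfolding marked_dist_def by simp
next
  fix X Y :: "('x::finite, 'a) marked_class"
  assume "X \<in> marked_space" "Y \<in> marked_space"
  then obtain G H S T where
    "marked_group G S" "X = marked_class G S" "marked_group H T" "Y = marked_class H T"
    unfolding marked_space_def by blast
  then show "marked_dist X Y = 0 \<longleftrightarrow> X = Y"
    by (simp add: marked_dist_eq_0_iff marked_class_eq_iff marked_iso_iff_relations)
next
  fix X Y Z :: "('x::finite, 'a) marked_class"
  assume "X \<in> marked_space" "Y \<in> marked_space" "Z \<in> marked_space"
  then have "marked_dist X Z \<le> max (marked_dist X Y) (marked_dist Y Z)"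
    unfolding marked_space_def using marked_dist_ultrametric by blast
  then show "marked_dist X Z \<le> marked_dist X Y + marked_dist Y Z"
    using marked_dist_nonneg[of X Y] marked_dist_nonneg[of Y Z] by linarith
qed

lemma relators_closed: "relators_G_seq n \<subseteq> carrier F3" "relators_G \<subseteq> carrier F3"
proof -
  interpret group F3 by (rule group_free_group)
  show "relators_G_seq n \<subseteq> carrier F3" "relators_G \<subseteq> carrier F3"
    using basis_elt_closed[of Gen_a] basis_elt_closed[of Gen_b] basis_elt_closed[of Gen_c]
    by (auto simp: relators_G_seq_def relators_G_def R1_def R2_def commutator_def conj_by_def)
qed

end

theory Submission
  imports Defs
begin

text \<open>
  Put \<open>x(i,j) = c\<^sup>-\<^sup>i a\<^sup>-\<^sup>j b a\<^sup>j c\<^sup>i\<close> for integers \<open>i, j\<close>. The relators of \<open>G\<close> say that \<open>a\<close> and \<open>c\<close>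
  commute and that \<open>x(q)\<^sup>-\<^sup>1 x(r) x(q) = x(r + (0,1))\<close> whenever \<open>q < r\<close> lexicographically. In \<open>G\<^sub>n\<close> one
  has \<open>x(i,j) = x(0, n i + j)\<close>, and the relations of Thompson's group give the same identity
  whenever \<open>n i + j\<close> increases from \<open>q\<close> to \<open>r\<close>; for a given pair \<open>q < r\<close> this holds for large \<open>n\<close>.
  So every relation of \<open>G\<close> holds in \<open>G\<^sub>n\<close> for large \<open>n\<close>.

  Conversely, the relations of \<open>G\<close> bring every element into the form \<open>a\<^sup>m c\<^sup>p P Q\<^sup>-\<^sup>1\<close> with \<open>P, Q\<close>
  products of elements \<open>x(i,j)\<close>. The group \<open>G\<^sub>n\<close> acts on the line, \<open>a\<close> and \<open>c\<close> by the
  translations by \<open>1\<close> and \<open>n\<close>, and \<open>x(i,j)\<close> by a map that moves exactly the points left of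
  \<open>-(n i + j)\<close>, each of them to the right. If the element is trivial in \<open>G\<^sub>n\<close> for infinitely many
  \<open>n\<close>, the action near \<open>+\<infinity>\<close> gives \<open>m + p n = 0\<close>, hence \<open>m = p = 0\<close>, and \<open>P, Q\<close> act equally.
  Moving their least factors to the front, these can be read off from the sets of moved points,
  hence agree; cancelling them, \<open>P = Q\<close> in \<open>G\<close> by induction.
\<close>

section \<open>Conjugation and commutators\<close>

text \<open>
  The constants of the definitions take a plain \<open>monoid\<close>, whereas the locale \<open>group\<close> is
  stated for record extensions.
\<close>

locale plain_group = group G for G :: "'a monoid" (structure)
begin

lemma inv_mult_cancel:
  assumes "x \<in> carrier G" "y \<in> carrier G"
  shows "inv x \<otimes> (x \<otimes> y) = y" "x \<otimes> (inv x \<otimes> y) = y"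
  using assms by (simp_all add: m_assoc[symmetric])

lemma conj_by_closed [simp]: "x \<in> carrier G \<Longrightarrow> y \<in> carrier G \<Longrightarrow> conj_by G x y \<in> carrier G"
  by (simp add: conj_by_def)

lemma conj_by_one [simp]: "y \<in> carrier G \<Longrightarrow> conj_by G \<one> y = y"
  by (simp add: conj_by_def)

lemma conj_by_mult:
  assumes "x \<in> carrier G" "y \<in> carrier G" "z \<in> carrier G"
  shows "conj_by G x (y \<otimes> z) = conj_by G x y \<otimes> conj_by G x z"
  using assms by (simp add: conj_by_def m_assoc inv_mult_cancel)

lemma conj_by_inv:
  assumes "x \<in> carrier G" "y \<in> carrier G"
  shows "conj_by G x (inv y) = inv (conj_by G x y)"
  using assms by (simp add: conj_by_def m_assoc inv_mult_group)

lemma conj_by_conj_by: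
  assumes "x \<in> carrier G" "y \<in> carrier G" "z \<in> carrier G"
  shows "conj_by G y (conj_by G x z) = conj_by G (x \<otimes> y) z"
  using assms by (simp add: conj_by_def m_assoc inv_mult_group)

lemma conj_by_distrib:
  assumes "x \<in> carrier G" "y \<in> carrier G" "z \<in> carrier G"
  shows "conj_by G z (conj_by G x y) = conj_by G (conj_by G z x) (conj_by G z y)"
  using assms by (simp add: conj_by_def m_assoc inv_mult_group inv_mult_cancel)

lemma mult_conj_by:
  assumes "x \<in> carrier G" "y \<in> carrier G"
  shows "x \<otimes> conj_by G x y = y \<otimes> x"
  using assms by (simp add: conj_by_def m_assoc inv_mult_cancel)

lemma conj_by_eqI:
  assumes "x \<otimes> z = y \<otimes> x" "x \<in> carrier G" "y \<in> carrier G" "z \<in> carrier G"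
  shows "conj_by G x y = z"
  using mult_conj_by[of x y] Units_l_cancel[of x "conj_by G x y" z] assms by auto

lemma conj_by_eq_self_iff:
  assumes "x \<in> carrier G" "y \<in> carrier G"
  shows "conj_by G x y = y \<longleftrightarrow> x \<otimes> y = y \<otimes> x"
  using mult_conj_by[OF assms] Units_l_cancel[of x "conj_by G x y" y] assms by auto

text \<open>Turns an exchange rule for two factors into one that moves an inverse factor to the
  right.\<close>

lemma inv_mult_swap:
  assumes "x \<otimes> y = z \<otimes> w"
    and "x \<in> carrier G" "y \<in> carrier G" "z \<in> carrier G" "w \<in> carrier G"
  shows "inv z \<otimes> x = w \<otimes> inv y"
proof -
  have "inv z \<otimes> x = inv z \<otimes> (x \<otimes> y) \<otimes> inv y"
    using assms(2-5) by (simp add: m_assoc)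
  also have "\<dots> = inv z \<otimes> (z \<otimes> w) \<otimes> inv y"
    by (simp only: assms(1))
  finally show ?thesis
    using assms(2-5) by (simp add: m_assoc[symmetric])
qed

lemma commutator_eq_one_iff:
  assumes "x \<in> carrier G" "y \<in> carrier G"
  shows "commutator G x y = \<one> \<longleftrightarrow> conj_by G x y = y"
proof -
  have "commutator G x y \<otimes> (y \<otimes> x) = x \<otimes> y"
    using assms by (simp add: commutator_def m_assoc inv_mult_cancel)
  moreover have "commutator G x y \<in> carrier G"
    using assms by (simp add: commutator_def)
  ultimately have "commutator G x y = \<one> \<longleftrightarrow> x \<otimes> y = y \<otimes> x"
    using assms right_cancel[of "y \<otimes> x" "commutator G x y" \<one>] by auto
  then show ?thesis using assms by (simp add: conj_by_eq_self_iff)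
qed

text \<open>The product \<open>x \<otimes> inv y\<close> centralizes \<open>z\<close> exactly when
  \<open>x\<close> and \<open>y\<close> conjugate \<open>z\<close> alike. With \<open>x\<close> a
  translate of \<open>b\<close> and \<open>y\<close> the generator \<open>a\<close>, this turns the
  relators into conjugation rules.\<close>

lemma commutator_mult_inv_eq_one_iff:
  assumes "x \<in> carrier G" "y \<in> carrier G" "z \<in> carrier G"
  shows "commutator G (x \<otimes> inv y) z = \<one> \<longleftrightarrow> conj_by G x z = conj_by G y z"
proof -
  let ?u = "conj_by G (x \<otimes> inv y) z"
  have "conj_by G y ?u = conj_by G x z"
    using assms by (simp add: conj_by_conj_by m_assoc)
  moreover have "conj_by G y u = conj_by G y v \<longleftrightarrow> u = v"
    if "u \<in> carrier G" "v \<in> carrier G" for u v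
    using that assms by (simp add: conj_by_def m_assoc)
  ultimately show ?thesis using assms by (auto simp: commutator_eq_one_iff)
qed

lemma conj_by_int_pow:
  assumes "x \<in> carrier G" "y \<in> carrier G"
  shows "conj_by G x (y [^] (k::int)) = conj_by G x y [^] k"
proof -
  have "conj_by G x \<in> hom G G"
    using assms by (auto simp: hom_def conj_by_mult)
  then show ?thesis
    using assms by (intro hom_int_pow) (auto simp: is_group)
qed

lemma int_pow_commute:
  assumes "x \<in> carrier G" "y \<in> carrier G" "x \<otimes> y = y \<otimes> x"
  shows "x [^] (i::int) \<otimes> y [^] (j::int) = y [^] j \<otimes> x [^] i"
proof -
  \<comment> \<open>Conjugation by \<open>u\<close> is a homomorphism; if it fixes \<open>v\<close>,
    it fixes every power of \<open>v\<close>. This is used once for each exponent.\<close>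
  have *: "u \<otimes> v [^] k = v [^] k \<otimes> u"
    if "u \<in> carrier G" "v \<in> carrier G" "u \<otimes> v = v \<otimes> u" for u v and k :: int
    using that by (simp add: conj_by_eq_self_iff[symmetric] conj_by_int_pow)
  have "y [^] j \<otimes> x = x \<otimes> y [^] j"
    using assms by (intro *[symmetric]) auto
  then show ?thesis
    using assms by (intro *[symmetric]) auto
qed

end

lemma hom_conj_by:
  assumes "group_hom G H h" "x \<in> carrier G" "y \<in> carrier G"
  shows "h (conj_by G x y) = conj_by H (h x) (h y)"
proof -
  interpret group_hom G H h by fact
  show ?thesis using assms by (simp add: conj_by_def)
qed

lemma hom_commutator:
  assumes "group_hom G H h" "x \<in> carrier G" "y \<in> carrier G"
  shows "h (commutator G x y) = commutator H (h x) (h y)"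
proof -
  interpret group_hom G H h by fact
  show ?thesis using assms by (simp add: commutator_def)
qed


section \<open>Groups marked by three elements\<close>

text \<open>The index lists the exponent of \<open>c\<close> first. Group and marking are
  parameters, so that the same products can be formed in the free group, in a presented group and on
  the line, and compared by evaluating words.\<close>

definition translate :: "'a monoid \<Rightarrow> (gen3 \<Rightarrow> 'a) \<Rightarrow> int \<times> int \<Rightarrow> 'a" where
  "translate G S r =
     conj_by G (S Gen_a [^]\<^bsub>G\<^esub> snd r \<otimes>\<^bsub>G\<^esub> S Gen_c [^]\<^bsub>G\<^esub> fst r) (S Gen_b)"

definition pos_word :: "'a monoid \<Rightarrow> (gen3 \<Rightarrow> 'a) \<Rightarrow> (int \<times> int) list \<Rightarrow> 'a" where
  "pos_word G S rs = foldr (\<lambda>r g. translate G S r \<otimes>\<^bsub>G\<^esub> g) rs \<one>\<^bsub>G\<^esub>"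

text \<open>The exponent of \<open>c\<close> dominates because \<open>c\<close> stands for a power
  of \<open>a\<close> that grows without bound.\<close>

definition lex_less :: "int \<times> int \<Rightarrow> int \<times> int \<Rightarrow> bool" where
  "lex_less q r \<longleftrightarrow> fst q < fst r \<or> fst q = fst r \<and> snd q < snd r"

definition succ_index :: "int \<times> int \<Rightarrow> int \<times> int" where
  "succ_index r = (fst r, snd r + 1)"

abbreviation relator_ijk :: "nat \<Rightarrow> nat \<Rightarrow> nat \<Rightarrow> gen3 word" where
  "relator_ijk i j k \<equiv> commutator F3
      (conj_by F3 (wa [^]\<^bsub>F3\<^esub> j) wb \<otimes>\<^bsub>F3\<^esub> inv\<^bsub>F3\<^esub> wa)
      (conj_by F3 (wc [^]\<^bsub>F3\<^esub> i) (conj_by F3 (wa [^]\<^bsub>F3\<^esub> k) wb))"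

locale three_gen = plain_group G for G :: "'a monoid" (structure) +
  fixes S :: "gen3 \<Rightarrow> 'a"
  assumes S_closed [simp]: "S x \<in> carrier G"
begin

abbreviation a where "a \<equiv> S Gen_a"
abbreviation b where "b \<equiv> S Gen_b"
abbreviation c where "c \<equiv> S Gen_c"
abbreviation X where "X \<equiv> translate G S"
abbreviation pos where "pos \<equiv> pos_word G S"

lemma X_closed [simp]: "X r \<in> carrier G"
  by (simp add: translate_def)

lemma X_zero [simp]: "X (0, 0) = b"
  by (simp add: translate_def)

lemma pos_Nil [simp]: "pos [] = \<one>"
  by (simp add: pos_word_def)

lemma pos_Cons [simp]: "pos (r # rs) = X r \<otimes> pos rs"
  by (simp add: pos_word_def)

lemma pos_closed [simp]: "pos rs \<in> carrier G"
  by (induction rs) auto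

lemma pos_append: "pos (rs @ qs) = pos rs \<otimes> pos qs"
  by (induction rs) (auto simp: m_assoc)

lemma range_S: "range S \<subseteq> carrier G"
  by auto

lemma eval_hom: "group_hom F3 G (eval_word G S)"
  by (rule group_hom_eval_word[OF is_group range_S])

lemma eval_basis_elt: "eval_word G S (basis_elt x) = S x"
  by (rule eval_word_basis_elt[OF is_group range_S])

lemma eval_translate: "eval_word G S (translate F3 basis_elt r) = X r"
proof -
  interpret h: group_hom F3 G "eval_word G S" by (rule eval_hom)
  show ?thesis
    by (simp add: translate_def hom_conj_by[OF eval_hom] basis_elt_closed h.hom_int_pow eval_basis_elt)
qed

lemma eval_pos_word: "eval_word G S (pos_word F3 basis_elt rs) = pos rs"
proof -
  interpret h: group_hom F3 G "eval_word G S" by (rule eval_hom)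
  interpret F: three_gen F3 basis_elt
    by unfold_locales (rule basis_elt_closed)
  show ?thesis by (induction rs) (simp_all add: eval_translate)
qed

lemma conj_pow_b: "conj_by G (a [^] (k::nat)) b = X (0, int k)"
  by (simp add: translate_def int_pow_int)

lemma eval_relator:
  "eval_word G S (relator_ijk i j k)
   = commutator G (X (0, int j) \<otimes> inv a) (X (int i, int k))"
proof -
  interpret h: group_hom F3 G "eval_word G S" by (rule eval_hom)
  interpret F: three_gen F3 basis_elt
    by unfold_locales (rule basis_elt_closed)
  have "conj_by G (c [^] i) (conj_by G (a [^] k) b) = X (int i, int k)"
    by (simp add: conj_by_conj_by translate_def int_pow_int)
  then show ?thesis
    by (simp add: hom_commutator[OF eval_hom] hom_conj_by[OF eval_hom] eval_basis_elt h.hom_nat_pow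
        conj_pow_b)
qed

end

interpretation F3: three_gen F3 basis_elt
  by (simp add: three_gen_def plain_group_def group_free_group three_gen_axioms_def basis_elt_closed)

section \<open>Translation of indices and the infinite presentation of Thompson's group\<close>

locale commuting_gens = three_gen +
  assumes commute: "a \<otimes> c = c \<otimes> a"
begin

lemma pow_commute: "a [^] (i::int) \<otimes> c [^] (j::int) = c [^] j \<otimes> a [^] i"
  by (intro int_pow_commute commute) auto

lemma mult_pows:
  "(a [^] (j::int) \<otimes> c [^] (i::int)) \<otimes> (a [^] (l::int) \<otimes> c [^] (k::int))
     = a [^] (j + l) \<otimes> c [^] (i + k)"
proof -
  have "(a [^] j \<otimes> c [^] i) \<otimes> (a [^] l \<otimes> c [^] k)
      = a [^] j \<otimes> (c [^] i \<otimes> a [^] l) \<otimes> c [^] k"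
    by (simp add: m_assoc)
  also have "\<dots> = a [^] j \<otimes> (a [^] l \<otimes> c [^] i) \<otimes> c [^] k"
    by (simp only: pow_commute)
  finally show ?thesis by (simp add: m_assoc int_pow_mult)
qed

lemma conj_X: "conj_by G (a [^] (l::int) \<otimes> c [^] (k::int)) (X (i, j)) = X (i + k, j + l)"
  by (simp add: translate_def conj_by_conj_by mult_pows)

lemma conj_a_X: "conj_by G a (X r) = X (succ_index r)"
  using conj_X[of 1 0 "fst r" "snd r"] by (simp add: succ_index_def)

text \<open>Conjugation by a power of \<open>a\<close> times a power of \<open>c\<close> shifts all
  indices at once, so one instance of the rule yields all its translates.\<close>

lemma conj_X_X:
  assumes "conj_by G (X (i, j)) (X (i', j')) = X (i', j' + 1)"
  shows "conj_by G (X (i + k, j + l)) (X (i' + k, j' + l)) = X (i' + k, j' + 1 + l)"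
  using arg_cong[OF assms, of "conj_by G (a [^] l \<otimes> c [^] k)"]
  by (subst (asm) conj_by_distrib) (auto simp: conj_X)

text \<open>Derives the infinite presentation of Thompson's group from its two relators. With x_m
  for \<open>X (0, m)\<close>, strong induction shows that x_0 conjugates x_m to x_(m+1) for all m
  \<ge> 1; translating the indices gives the rest.\<close>

lemma thompson_relations:
  assumes "conj_by G (X (0, 0)) (X (0, 1)) = X (0, 2)"
    and "conj_by G (X (0, 0)) (X (0, 2)) = X (0, 3)"
    and "j < k"
  shows "conj_by G (X (i, j)) (X (i, k)) = X (i, k + 1)"
proof -
  have main: "conj_by G (X (0, 0)) (X (0, int m + 1)) = X (0, int m + 2)" for m
  proof (induction m rule: less_induct)
    case (less m)
    have "m = 0 \<or> m = 1 \<or> (\<exists>n. m = n + 2)" by presburger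
    then consider "m = 0" | "m = 1" | n where "m = n + 2" by blast
    then show ?case
    proof cases
      case 3
      have n: "conj_by G (X (0, 0)) (X (0, int n + 1)) = X (0, int n + 1 + 1)"
        and n1: "conj_by G (X (0, 0)) (X (0, int n + 2)) = X (0, int n + 2 + 1)"
        using less.IH[of n] less.IH[of "n + 1"] 3 by (auto simp: add.commute)
      \<comment> \<open>The induction hypothesis for \<open>n\<close>, translated by 1. Conjugating
        by x_0 replaces x_1 and x_(n+2) by x_2 and x_(n+3), and the same hypothesis translated by 2
        finishes.\<close>
      have "X (0, int n + 3) = conj_by G (X (0, 1)) (X (0, int n + 2))"
        using conj_X_X[OF n, of 0 1] by (simp add: add.commute)
      then have "conj_by G (X (0, 0)) (X (0, int n + 3))
          = conj_by G (conj_by G (X (0, 0)) (X (0, 1))) (conj_by G (X (0, 0)) (X (0, int n + 2)))"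
        by (simp add: conj_by_distrib[of "X (0, 1)" "X (0, int n + 2)" "X (0, 0)"] del: X_zero)
      also have "\<dots> = conj_by G (X (0, 2)) (X (0, int n + 3))"
        using n1 assms(1) by (simp add: add.commute)
      also have "\<dots> = X (0, int n + 4)"
        using conj_X_X[OF n, of 0 2] by (simp add: add.commute)
      finally show ?thesis using 3 by (simp add: add.commute)
    qed (use assms in auto)
  qed
  obtain m where "k = int m + 1 + j"
    using assms(3) by (metis add.assoc add.commute zless_iff_Suc_zadd of_nat_Suc)
  then show ?thesis
    using conj_X_X[of 0 0 0 "int m + 1" i j] main[of m]
    by (simp add: add.commute add.left_commute)
qed

lemma eval_relator_eq_one_iff:
  "eval_word G S (relator_ijk i j k) = \<one>
   \<longleftrightarrow> conj_by G (X (0, int j)) (X (int i, int k)) = X (int i, int k + 1)"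
  by (simp add: eval_relator commutator_mult_inv_eq_one_iff conj_a_X succ_index_def)

lemma eval_R1_eq_one_iff:
    "eval_word G S R1 = \<one> \<longleftrightarrow> conj_by G (X (0, 0)) (X (0, 1)) = X (0, 2)"
  and eval_R2_eq_one_iff:
    "eval_word G S R2 = \<one> \<longleftrightarrow> conj_by G (X (0, 0)) (X (0, 2)) = X (0, 3)"
  using eval_relator_eq_one_iff[of 0 0 1] eval_relator_eq_one_iff[of 0 0 2]
  by (simp_all add: R1_def R2_def)

end

section \<open>Normal forms from the conjugation rule\<close>

locale lex_group = commuting_gens +
  assumes conj_lex: "lex_less q r \<Longrightarrow> conj_by G (X q) (X r) = X (succ_index r)"
begin

lemma X_swap: "lex_less q r \<Longrightarrow> X r \<otimes> X q = X q \<otimes> X (succ_index r)"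
  using conj_lex[of q r] mult_conj_by[of "X q" "X r"] by simp

text \<open>By \<open>X_swap\<close> a smaller factor moves to the left past a larger one. This only
  raises the index of the factor it passes, so the moved factor stays minimal and the length is
  unchanged.\<close>

lemma pos_extract_min:
  assumes "rs \<noteq> []"
  shows "\<exists>q qs. pos rs = X q \<otimes> pos qs \<and> length rs = Suc (length qs)
           \<and> (\<forall>r\<in>set qs. \<not> lex_less r q)"
  using assms
proof (induction rs)
  case (Cons r rs)
  show ?case
  proof (cases "rs = []")
    case True
    then show ?thesis by (intro exI[of _ r] exI[of _ "[]"]) simp
  next
    case False
    then obtain q qs where q: "pos rs = X q \<otimes> pos qs" "length rs = Suc (length qs)"
        "\<forall>s\<in>set qs. \<not> lex_less s q"
      using Cons.IH by blast
    show ?thesis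
    proof (cases "lex_less q r")
      case True
      have "pos (r # rs) = X r \<otimes> X q \<otimes> pos qs" by (simp add: q(1) m_assoc)
      also have "\<dots> = X q \<otimes> X (succ_index r) \<otimes> pos qs" by (simp only: X_swap[OF True])
      finally have "pos (r # rs) = X q \<otimes> pos (succ_index r # qs)" by (simp add: m_assoc)
      moreover have "\<not> lex_less (succ_index r) q"
        using True by (auto simp: lex_less_def succ_index_def)
      ultimately show ?thesis
        using q(2,3) by (metis length_Cons set_ConsD)
    next
      case nless: False
      have "pos (r # rs) = X r \<otimes> pos (q # qs)" by (simp add: q(1))
      moreover have "\<not> lex_less s r" if "s \<in> set (q # qs)" for s
        using that q(3) nless by (auto simp: lex_less_def)
      ultimately show ?thesis
        using q(2) by (metis length_Cons)
    qed
  qed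
qed simp

text \<open>The inverse factor travels to the right: it cancels an equal factor, raises the index of
  a larger one, and has its own index raised by a smaller one. Hence the induction is over all
  \<open>q\<close>.\<close>

lemma inv_X_pos: "\<exists>ps' qs'. inv (X q) \<otimes> pos ps = pos ps' \<otimes> inv (pos qs')"
proof (induction ps arbitrary: q)
  case Nil
  show ?case by (intro exI[of _ "[]"] exI[of _ "[q]"]) simp
next
  case (Cons r ps)
  have "q = r \<or> lex_less q r \<or> lex_less r q"
    unfolding lex_less_def prod_eq_iff by linarith
  then consider "q = r" | "lex_less q r" | "lex_less r q" by blast
  then show ?case
  proof cases
    case 1
    then show ?thesis
      by (intro exI[of _ ps] exI[of _ "[]"]) (simp add: m_assoc[symmetric])
  next
    case 2
    obtain ps' qs' where IH: "inv (X q) \<otimes> pos ps = pos ps' \<otimes> inv (pos qs')"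
      using Cons.IH by blast
    have "inv (X q) \<otimes> X r = X (succ_index r) \<otimes> inv (X q)"
      using inv_mult_swap[OF X_swap[OF 2]] by simp
    then have "inv (X q) \<otimes> pos (r # ps) = X (succ_index r) \<otimes> (inv (X q) \<otimes> pos ps)"
      by (simp add: m_assoc[symmetric])
    then have "inv (X q) \<otimes> pos (r # ps) = pos (succ_index r # ps') \<otimes> inv (pos qs')"
      by (simp add: IH m_assoc)
    then show ?thesis by blast
  next
    case 3
    obtain ps' qs' where IH: "inv (X (succ_index q)) \<otimes> pos ps = pos ps' \<otimes> inv (pos qs')"
      using Cons.IH by blast
    have "inv (X q) \<otimes> X r = X r \<otimes> inv (X (succ_index q))"
      using inv_mult_swap[OF X_swap[OF 3, symmetric]] by simp
    then have "inv (X q) \<otimes> pos (r # ps) = X r \<otimes> (inv (X (succ_index q)) \<otimes> pos ps)"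
      by (simp add: m_assoc[symmetric])
    then have "inv (X q) \<otimes> pos (r # ps) = pos (r # ps') \<otimes> inv (pos qs')"
      by (simp add: IH m_assoc)
    then show ?thesis by blast
  qed
qed

text \<open>Letters are multiplied on from the left. Powers of \<open>a\<close> and \<open>c\<close>
  merge with the front; \<open>b\<close> or its inverse passes the front, becoming a translate or
  its inverse, and the latter is absorbed by \<open>inv_X_pos\<close>.\<close>

lemma eval_word_factorization:
  "\<exists>(m::int) (p::int) ps qs.
     eval_word G S w = a [^] m \<otimes> c [^] p \<otimes> (pos ps \<otimes> inv (pos qs))"
proof (induction w)
  case Nil
  show ?case
    by (intro exI[of _ 0] exI[of _ "[]"]) (simp add: eval_word_def)
next
  case (Cons l w)
  obtain m p :: int and ps qs
    where IH: "eval_word G S w = a [^] m \<otimes> c [^] p \<otimes> (pos ps \<otimes> inv (pos qs))"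
    using Cons by blast
  obtain x e where l: "l = (x, e)" by (cases l)
  have ev: "eval_word G S (l # w)
      = (if e then S x else inv (S x)) \<otimes> (a [^] m \<otimes> c [^] p) \<otimes> (pos ps \<otimes> inv (pos qs))"
    using IH by (simp add: eval_word_def l m_assoc)
  consider "x = Gen_a" | "x = Gen_b" | "x = Gen_c" by (cases x)
  then show ?case
  proof cases
    case 1
    have e: "(if e then a else inv a) = a [^] (if e then 1 else - 1 :: int) \<otimes> c [^] (0::int)"
      using int_pow_neg[of a 1] by simp
    then have "eval_word G S (l # w)
        = (a [^] (if e then 1 else - 1 :: int) \<otimes> c [^] (0::int)) \<otimes> (a [^] m \<otimes> c [^] p) \<otimes> (pos ps \<otimes> inv (pos qs))"
      by (simp only: ev 1 e)
    then show ?thesis unfolding mult_pows by blast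
  next
    case 3
    have e: "(if e then c else inv c) = a [^] (0::int) \<otimes> c [^] (if e then 1 else - 1 :: int)"
      using int_pow_neg[of c 1] by simp
    then have "eval_word G S (l # w)
        = (a [^] (0::int) \<otimes> c [^] (if e then 1 else - 1 :: int)) \<otimes> (a [^] m \<otimes> c [^] p) \<otimes> (pos ps \<otimes> inv (pos qs))"
      by (simp only: ev 3 e)
    then show ?thesis unfolding mult_pows by blast
  next
    case 2
    let ?y = "a [^] m \<otimes> c [^] p"
    have X: "conj_by G ?y b = X (p, m)" by (simp add: translate_def)
    show ?thesis
    proof (cases e)
      case True
      have "b \<otimes> ?y = ?y \<otimes> X (p, m)" using mult_conj_by[of ?y b] by (simp add: X)
      then have "eval_word G S (l # w) = ?y \<otimes> (pos ((p, m) # ps) \<otimes> inv (pos qs))"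
        unfolding ev using 2 True by (simp add: m_assoc)
      then show ?thesis by blast
    next
      case False
      obtain ps' qs' where pq: "inv (X (p, m)) \<otimes> pos ps = pos ps' \<otimes> inv (pos qs')"
        using inv_X_pos by blast
      have "inv b \<otimes> ?y = ?y \<otimes> inv (X (p, m))"
        using mult_conj_by[of ?y "inv b"] by (simp add: X conj_by_inv)
      then have "eval_word G S (l # w) = ?y \<otimes> (inv (X (p, m)) \<otimes> pos ps \<otimes> inv (pos qs))"
        unfolding ev using 2 False by (simp add: m_assoc)
      also have "\<dots> = ?y \<otimes> (pos ps' \<otimes> inv (pos (qs @ qs')))"
        by (simp add: pq pos_append inv_mult_group m_assoc)
      finally show ?thesis by blast
    qed
  qed
qed

end

section \<open>Actions on the line\<close>

definition bij_group :: "('b \<Rightarrow> 'b) monoid" where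
  "bij_group = \<lparr>carrier = {f. bij f}, mult = (\<circ>), one = id\<rparr>"

lemma plain_group_bij_group: "plain_group bij_group"
  unfolding plain_group_def
proof (rule groupI)
  fix f :: "'b \<Rightarrow> 'b"
  assume "f \<in> carrier bij_group"
  then show "\<exists>g\<in>carrier bij_group. g \<otimes>\<^bsub>bij_group\<^esub> f = \<one>\<^bsub>bij_group\<^esub>"
    by (intro bexI[of _ "inv_into UNIV f"]) (auto simp: bij_group_def bij_imp_bij_inv bij_is_inj)
qed (auto simp: bij_group_def bij_comp)

text \<open>The standard piecewise linear generators of Thompson's group on the line: the shift by 1
  up to -k-2, slope 1/2 from -k-2 to -k, and the identity from -k on.\<close>

definition bump :: "real \<Rightarrow> real \<Rightarrow> real" where
  "bump k t = min (t + 1) (max t ((t - k) / 2))"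

lemma bump_ge: "t \<le> bump k t"
  by (simp add: bump_def)

lemma bump_eq_iff: "bump k t = t \<longleftrightarrow> - k \<le> t"
  by (auto simp: bump_def min_def max_def field_simps)

lemma bump_translate: "bump k (t + s) = bump (k + s) t + s"
  by (auto simp: bump_def min_def max_def field_simps)

text \<open>Points left of -(k+1) \<le> -2 lie where \<open>bump 0\<close> is the shift by 1, which
  changes the index by 1. The other points are fixed by \<open>bump (k + 1)\<close>, and
  \<open>bump 0\<close> sends them to points \<ge> -k, fixed by \<open>bump k\<close>.\<close>

lemma bump_bump:
  assumes "k \<ge> 1"
  shows "bump 0 (bump (k + 1) t) = bump k (bump 0 t)"
  using assms by (auto simp: bump_def min_def max_def field_simps)

lemma bij_bump: "bij (bump k)"
proof (rule o_bij)
  \<comment> \<open>Each linear piece is inverted; the inverse exchanges the roles of minimum and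
    maximum.\<close>
  let ?g = "\<lambda>s. max (s - 1) (min s (2 * s + k))"
  show "?g \<circ> bump k = id" "bump k \<circ> ?g = id"
    by (auto simp: bump_def min_def max_def field_simps fun_eq_iff)
qed

lemma bij_shift: "bij (\<lambda>t::real. t + s)"
  by (rule o_bij[of "\<lambda>t. t - s"]) (auto simp: fun_eq_iff)

primrec line_action :: "nat \<Rightarrow> gen3 \<Rightarrow> real \<Rightarrow> real" where
  "line_action n Gen_a = (\<lambda>t. t + 1)"
| "line_action n Gen_b = bump 0"
| "line_action n Gen_c = (\<lambda>t. t + real n)"

text \<open>The total exponent of \<open>a\<close> once \<open>c\<close> is replaced by its
  \<open>n\<close>-th power.\<close>

definition height :: "nat \<Rightarrow> int \<times> int \<Rightarrow> int" where
  "height n r = int n * fst r + snd r"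

interpretation L: commuting_gens bij_group "line_action n" for n
proof -
  interpret plain_group "bij_group :: (real \<Rightarrow> real) monoid" by (rule plain_group_bij_group)
  show "commuting_gens bij_group (line_action n)"
  proof
    show "line_action n x \<in> carrier bij_group" for x
      by (cases x) (auto simp: bij_group_def bij_bump bij_shift)
  qed (auto simp: bij_group_def)
qed

declare L.pos_Nil [simp del] L.pos_Cons [simp del]

lemma shift_nat_pow: "(\<lambda>t::real. t + s) [^]\<^bsub>bij_group\<^esub> (k::nat) = (\<lambda>t. t + real k * s)"
  by (induction k) (auto simp: bij_group_def fun_eq_iff algebra_simps)

lemma shift_int_pow: "(\<lambda>t::real. t + s) [^]\<^bsub>bij_group\<^esub> (k::int) = (\<lambda>t. t + of_int k * s)"
proof (cases k rule: int_cases2)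
  case (nonneg m)
  then show ?thesis by (simp add: int_pow_int shift_nat_pow)
next
  case (nonpos m)
  have "inv\<^bsub>bij_group\<^esub> (\<lambda>t::real. t + real m * s) = (\<lambda>t. t + of_int k * s)"
    using bij_shift[of "- (real m * s)"]
    by (intro L.inv_equality) (auto simp: bij_group_def bij_shift nonpos fun_eq_iff)
  then show ?thesis
    using L.int_pow_neg_int[of "\<lambda>t. t + s" m]
    by (simp add: shift_nat_pow nonpos) (simp add: bij_group_def bij_shift)
qed

lemma shifts_mult:
  "line_action n Gen_a [^]\<^bsub>bij_group\<^esub> (m::int) \<otimes>\<^bsub>bij_group\<^esub>
     line_action n Gen_c [^]\<^bsub>bij_group\<^esub> (p::int) = (\<lambda>t. t + of_int (height n (p, m)))"
  by (auto simp: shift_int_pow height_def) (auto simp: bij_group_def fun_eq_iff algebra_simps)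

text \<open>Conjugating by the shift by the height h moves the endpoint of the fixed half-line from
  0 to -h.\<close>

lemma translate_line_action:
  "translate bij_group (line_action n) r = bump (of_int (height n r))"
  unfolding translate_def shifts_mult prod.collapse
  by (rule L.conj_by_eqI) (auto simp: bij_group_def bij_bump bij_shift fun_eq_iff bump_translate)

text \<open>Makes the action factor through G_n. The two Thompson relators are
  \<open>bump_bump\<close> for k = 1 and k = 2; the last one says that n unit shifts make the shift
  by n.\<close>

lemma line_action_relators: "relators_G_seq n \<subseteq> relations bij_group (line_action n)"
proof -
  interpret h: group_hom F3 bij_group "eval_word bij_group (line_action n)"
    by (rule L.eval_hom)
  have conj: "conj_by bij_group (bump 0) (bump k) = bump (k + 1)" if "k \<ge> 1" for k
    using that by (intro L.conj_by_eqI) (auto simp: bij_group_def bij_bump fun_eq_iff bump_bump)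
  have "eval_word bij_group (line_action n) R1 = \<one>\<^bsub>bij_group\<^esub>"
    unfolding L.eval_R1_eq_one_iff translate_line_action
    using conj[of 1] by (simp add: height_def)
  moreover have "eval_word bij_group (line_action n) R2 = \<one>\<^bsub>bij_group\<^esub>"
    unfolding L.eval_R2_eq_one_iff translate_line_action
    using conj[of 2] by (simp add: height_def)
  moreover have "eval_word bij_group (line_action n)
      (inv\<^bsub>F3\<^esub> wc \<otimes>\<^bsub>F3\<^esub> wa [^]\<^bsub>F3\<^esub> n) = \<one>\<^bsub>bij_group\<^esub>"
    using L.S_closed[of n Gen_c]
    by (simp add: h.hom_nat_pow basis_elt_closed L.eval_basis_elt shift_nat_pow)
  ultimately show ?thesis
    using relators_closed(1)[of n] by (auto simp: relations_def kernel_def relators_G_seq_def)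
qed

section \<open>Positive products as maps of the line\<close>

abbreviation line_pos :: "nat \<Rightarrow> (int \<times> int) list \<Rightarrow> real \<Rightarrow> real" where
  "line_pos n \<equiv> pos_word bij_group (line_action n)"

lemma line_pos_Nil: "line_pos n [] = id"
  by (simp add: pos_word_def) (simp add: bij_group_def)

lemma line_pos_Cons: "line_pos n (r # rs) t = bump (of_int (height n r)) (line_pos n rs t)"
  unfolding L.pos_Cons translate_line_action by (simp add: bij_group_def)

lemma line_pos_ge: "t \<le> line_pos n rs t"
proof (induction rs)
  case (Cons r rs)
  then show ?case using bump_ge order_trans unfolding line_pos_Cons by blast
qed (simp add: line_pos_Nil)

lemma line_pos_eq:
  assumes "\<forall>r\<in>set rs. - of_int (height n r) \<le> t"
  shows "line_pos n rs t = t"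
  using assms by (induction rs) (simp_all add: line_pos_Nil line_pos_Cons bump_eq_iff)

text \<open>No factor moves a point to the left, so displacements cannot cancel and a fixed point is
  fixed by every factor. The factor of least height has the smallest fixed half-line.\<close>

lemma line_pos_Cons_eq_iff:
  assumes "\<forall>r\<in>set rs. height n q \<le> height n r"
  shows "line_pos n (q # rs) t = t \<longleftrightarrow> - of_int (height n q) \<le> t"
proof
  assume "- of_int (height n q) \<le> t"
  moreover from this have "\<forall>r\<in>set rs. - of_int (height n r) \<le> t"
    using assms by force
  ultimately show "line_pos n (q # rs) t = t"
    by (intro line_pos_eq) auto
next
  assume eq: "line_pos n (q # rs) t = t"
  then have "line_pos n rs t = t"
    using bump_ge[of "line_pos n rs t" "of_int (height n q)"] line_pos_ge[of t n rs]
    unfolding line_pos_Cons by linarith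
  then show "- of_int (height n q) \<le> t"
    using eq unfolding line_pos_Cons by (simp add: bump_eq_iff)
qed

text \<open>Equal maps have equal fixed half-lines, hence equal endpoints.\<close>

lemma line_pos_Cons_height_eq:
  assumes "line_pos n (p # ps) = line_pos n (q # qs)"
    and "\<forall>r\<in>set ps. height n p \<le> height n r" "\<forall>r\<in>set qs. height n q \<le> height n r"
  shows "height n p = height n q"
proof -
  have "- of_int (height n p) \<le> t \<longleftrightarrow> - of_int (height n q) \<le> t" for t :: real
    using assms line_pos_Cons_eq_iff by metis
  from this[of "- of_int (height n p)"] this[of "- of_int (height n q)"] show ?thesis by simp
qed

lemma line_pos_Cons_neq_id:
  assumes "\<forall>r\<in>set rs. height n q \<le> height n r"
  shows "line_pos n (q # rs) \<noteq> id"
proof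
  assume "line_pos n (q # rs) = id"
  then have "- of_int (height n q) \<le> t" for t :: real
    using line_pos_Cons_eq_iff[OF assms, of t] by simp
  from this[of "- of_int (height n q) - 1"] show False by simp
qed

text \<open>Far enough to the right every factor is the identity. One common fixed point suffices to
  read off the translation part of a factorization.\<close>

lemma line_pos_eq_eventually: "\<exists>t. line_pos n ps t = t \<and> line_pos n qs t = t"
proof -
  let ?A = "(\<lambda>r. - of_int (height n r) :: real) ` set (ps @ qs)"
  have "bdd_above ?A" by (intro bdd_above_finite) auto
  then obtain t where "\<forall>x\<in>?A. x \<le> t" by (auto simp: bdd_above_def)
  then show ?thesis
    by (intro exI[of _ t] conjI line_pos_eq) auto
qed

section \<open>Comparison of heights for large n\<close>

lemma lex_less_height:
  assumes "lex_less q r"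
  shows "\<forall>\<^sub>F n in sequentially. height n q < height n r"
proof (cases "fst q < fst r")
  case True
  \<comment> \<open>A gain of at least 1 in the first component is worth at least \<open>n\<close>,
    which exceeds any loss in the second.\<close>
  have "height n q < height n r" if "n \<ge> nat (snd q - snd r) + 1" for n
  proof -
    have "int n * 1 \<le> int n * (fst r - fst q)"
      using True by (intro mult_left_mono) auto
    then show ?thesis using that by (simp add: height_def algebra_simps)
  qed
  then show ?thesis unfolding eventually_sequentially by blast
next
  case False
  then show ?thesis using assms by (simp add: lex_less_def height_def)
qed

lemma not_lex_less_height:
  assumes "\<forall>r\<in>A. \<not> lex_less r q" "finite A"
  shows "\<forall>\<^sub>F n in sequentially. \<forall>r\<in>A. height n q \<le> height n r"
proof (rule eventually_ball_finite[OF assms(2)], rule ballI)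
  fix r assume "r \<in> A"
  then have "\<not> lex_less r q" using assms(1) by blast
  then have "r = q \<or> lex_less q r"
    unfolding lex_less_def prod_eq_iff by linarith
  then show "\<forall>\<^sub>F n in sequentially. height n q \<le> height n r"
    using lex_less_height[of q r] by (auto elim!: eventually_mono)
qed

text \<open>Heights are affine in \<open>n\<close>, with the components of the index as
  coefficients; two that agree infinitely often coincide.\<close>

lemma frequently_height_eq:
  assumes "\<exists>\<^sub>F n in sequentially. height n q = height n r"
  shows "q = r"
proof (rule ccontr)
  assume "q \<noteq> r"
  then have "lex_less q r \<or> lex_less r q"
    unfolding lex_less_def prod_eq_iff by linarith
  then have "\<forall>\<^sub>F n in sequentially. height n q \<noteq> height n r"
    using lex_less_height[of q r] lex_less_height[of r q] by (auto elim!: eventually_mono)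
  then show False using assms by (simp add: frequently_def)
qed

text \<open>The hypothesis \<open>transfer\<close> ties the abstract group to the line actions. Each
  round of the induction discards only finitely many \<open>n\<close>, so infinitely many
  remain.\<close>

lemma (in lex_group) pos_eqI:
  assumes transfer: "\<And>ps qs. pos ps = pos qs \<Longrightarrow> \<forall>\<^sub>F n in sequentially. line_pos n ps = line_pos n qs"
    and "\<exists>\<^sub>F n in sequentially. line_pos n ps = line_pos n qs"
  shows "pos ps = pos qs"
  using assms(2)
proof (induction "length ps" arbitrary: ps qs rule: less_induct)
  case less
  \<comment> \<open>Once the least factor stands in front, both the rewriting and the minimality
    carry over to the line for all large \<open>n\<close>.\<close>
  have min: "\<exists>q qs. pos rs = pos (q # qs) \<and> length rs = Suc (length qs) \<and>
      (\<forall>\<^sub>F n in sequentially. line_pos n rs = line_pos n (q # qs) \<and>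
        (\<forall>r\<in>set qs. height n q \<le> height n r))" if rs: "rs \<noteq> []" for rs
  proof -
    obtain q qs where q: "pos rs = pos (q # qs)" "length rs = Suc (length qs)"
        "\<forall>r\<in>set qs. \<not> lex_less r q"
      using pos_extract_min[OF rs] by auto
    have "\<forall>\<^sub>F n in sequentially. line_pos n rs = line_pos n (q # qs) \<and>
        (\<forall>r\<in>set qs. height n q \<le> height n r)"
      using q by (intro eventually_conj transfer not_lex_less_height) auto
    then show ?thesis using q by blast
  qed
  show ?case
  proof (cases "ps = [] \<or> qs = []")
    case True
    \<comment> \<open>A nonempty product moves some point for all large \<open>n\<close>, so an
      empty list on one side forces an empty list on the other.\<close>
    have "rs = []" if "\<exists>\<^sub>F n in sequentially. line_pos n rs = id" for rs
    proof (rule ccontr)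
      assume "rs \<noteq> []"
      then obtain q qs where "\<forall>\<^sub>F n in sequentially. line_pos n rs = line_pos n (q # qs) \<and>
          (\<forall>r\<in>set qs. height n q \<le> height n r)"
        using min by blast
      then have "\<forall>\<^sub>F n in sequentially. line_pos n rs \<noteq> id"
        by (rule eventually_mono) (use line_pos_Cons_neq_id in metis)
      then show False using that by (simp add: frequently_def)
    qed
    from this[of ps] this[of qs] show ?thesis
      using less.prems True by (auto simp: line_pos_Nil eq_commute[of id])
  next
    case False
    obtain p ps' where p: "pos ps = pos (p # ps')" "length ps = Suc (length ps')"
        "\<forall>\<^sub>F n in sequentially. line_pos n ps = line_pos n (p # ps') \<and>
          (\<forall>r\<in>set ps'. height n p \<le> height n r)"
      using min[of ps] False by blast
    obtain q qs' where q: "pos qs = pos (q # qs')"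
        "\<forall>\<^sub>F n in sequentially. line_pos n qs = line_pos n (q # qs') \<and>
          (\<forall>r\<in>set qs'. height n q \<le> height n r)"
      using min[of qs] False by blast
    have freq: "\<exists>\<^sub>F n in sequentially. line_pos n ps = line_pos n qs \<and>
        (line_pos n ps = line_pos n (p # ps') \<and> (\<forall>r\<in>set ps'. height n p \<le> height n r)) \<and>
        (line_pos n qs = line_pos n (q # qs') \<and> (\<forall>r\<in>set qs'. height n q \<le> height n r))"
      using less.prems eventually_conj[OF p(3) q(2)] by (rule frequently_eventually_frequently)
    have "\<exists>\<^sub>F n in sequentially. height n p = height n q"
      using freq by (rule frequently_elim1) (metis line_pos_Cons_height_eq)
    then have pq: "p = q" by (rule frequently_height_eq)
    have "\<exists>\<^sub>F n in sequentially. line_pos n ps' = line_pos n qs'"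
      using freq
    proof (rule frequently_elim1)
      fix n
      assume "line_pos n ps = line_pos n qs \<and>
        (line_pos n ps = line_pos n (p # ps') \<and> (\<forall>r\<in>set ps'. height n p \<le> height n r)) \<and>
        (line_pos n qs = line_pos n (q # qs') \<and> (\<forall>r\<in>set qs'. height n q \<le> height n r))"
      \<comment> \<open>The common first factor acts bijectively and can be cancelled on the
        left.\<close>
      then have "line_pos n (q # ps') = line_pos n (q # qs')" using pq by metis
      then show "line_pos n ps' = line_pos n qs'" by (simp add: L.pos_Cons)
    qed
    then have "pos ps' = pos qs'" using less.hyps[of ps' qs'] p(2) by simp
    then show ?thesis using p(1) q(1) pq by simp
  qed
qed

section \<open>Convergence\<close>

lemma normal_closure_subset:
  assumes "N \<lhd> G" "R \<subseteq> N"
  shows "normal_closure G R \<subseteq> N"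
proof -
  interpret normal N G by fact
  have "{g \<otimes>\<^bsub>G\<^esub> r \<otimes>\<^bsub>G\<^esub> inv\<^bsub>G\<^esub> g | g r. g \<in> carrier G \<and> r \<in> R} \<subseteq> N"
    using assms(2) inv_op_closed2 by auto
  then show ?thesis
    unfolding normal_closure_def by (intro generate_subgroup_incl is_subgroup)
qed

lemma subset_normal_closure:
  assumes "group G" "R \<subseteq> carrier G"
  shows "R \<subseteq> normal_closure G R"
proof
  interpret group G by fact
  fix r assume r: "r \<in> R"
  then have "r = \<one>\<^bsub>G\<^esub> \<otimes>\<^bsub>G\<^esub> r \<otimes>\<^bsub>G\<^esub> inv\<^bsub>G\<^esub> \<one>\<^bsub>G\<^esub>" using assms(2) by auto
  then show "r \<in> normal_closure G R"
    unfolding normal_closure_def using r by (intro generate.incl) blast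
qed

text \<open>Evaluation and the quotient map are homomorphisms that agree on the basis, which
  generates the free group.\<close>

lemma eval_word_quotient:
  fixes N :: "'x::finite word set"
  assumes "N \<lhd> free_group" "w \<in> carrier free_group"
  shows "eval_word (free_group Mod N) (\<lambda>x. N #>\<^bsub>free_group\<^esub> basis_elt x) w
         = N #>\<^bsub>free_group\<^esub> w"
proof -
  interpret normal N free_group by fact
  let ?S = "\<lambda>x. N #>\<^bsub>free_group\<^esub> basis_elt x"
  have S: "range ?S \<subseteq> carrier (free_group Mod N)"
    using marked_group_quotient[OF assms(1)] by (simp add: marked_group_def)
  interpret h: group_hom free_group "free_group Mod N" "eval_word (free_group Mod N) ?S"
    by (rule group_hom_eval_word[OF factorgroup_is_group S])
  interpret k: group_hom free_group "free_group Mod N" "\<lambda>g. N #>\<^bsub>free_group\<^esub> g"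
    using factorgroup_is_group r_coset_hom_Mod group_free_group
    by (simp add: group_hom_def group_hom_axioms_def)
  have basis: "eval_word (free_group Mod N) ?S (basis_elt x) = ?S x" for x
    by (rule eval_word_basis_elt[OF factorgroup_is_group S])
  have "w \<in> generate free_group (range basis_elt)"
    using assms(2) by (simp add: generate_free_group)
  then show ?thesis
  proof (induction w rule: generate.induct)
    case one
    show ?case by (simp only: h.hom_one k.hom_one)
  next
    case (incl g)
    then show ?case using basis by auto
  next
    case (inv g)
    then show ?case
      using basis by (auto simp: basis_elt_closed simp del: inv_FactGroup)
  next
    case (eng g1 g2)
    have "g1 \<in> carrier free_group" "g2 \<in> carrier free_group"
      using eng.hyps by (simp_all add: generate_free_group)
    then show ?case using eng.IH by (simp only: h.hom_mult k.hom_mult)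
  qed
qed

text \<open>Reduces distances between presented groups to membership of words in normal
  closures.\<close>

lemma relations_presentation:
  fixes R :: "'x::finite word set"
  assumes "R \<subseteq> carrier free_group"
  shows "relations (presentation R) (presentation_gen R) = normal_closure free_group R"
proof -
  let ?N = "normal_closure free_group R"
  have N: "?N \<lhd> free_group" by (rule normal_normal_closure[OF group_free_group assms])
  interpret normal ?N free_group by (rule N)
  have "eval_word (presentation R) (presentation_gen R) w = \<one>\<^bsub>presentation R\<^esub> \<longleftrightarrow> w \<in> ?N"
    if "w \<in> carrier free_group" for w
  proof -
    have "eval_word (presentation R) (presentation_gen R) w = ?N #>\<^bsub>free_group\<^esub> w"
      using eval_word_quotient[OF N that]
      by (simp add: presentation_def presentation_gen_def[abs_def])
    moreover have "\<one>\<^bsub>presentation R\<^esub> = ?N" by (simp add: presentation_def FactGroup_def)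
    ultimately show ?thesis
      using that coset_join1[of ?N w] coset_join2[of w ?N] is_subgroup subset by auto
  qed
  then show ?thesis using subset by (auto simp: relations_def kernel_def)
qed

lemma three_gen_presentation:
  assumes "R \<subseteq> carrier F3"
  shows "three_gen (presentation R) (presentation_gen R)"
  using marked_group_presentation[OF assms]
  by (auto simp: three_gen_def plain_group_def three_gen_axioms_def marked_group_def)

lemma eval_word_presentation_eq_one:
  fixes R :: "'x::finite word set"
  assumes "R \<subseteq> carrier free_group" "w \<in> carrier free_group"
  shows "eval_word (presentation R) (presentation_gen R) w = \<one>\<^bsub>presentation R\<^esub>
         \<longleftrightarrow> w \<in> normal_closure free_group R"
  using relations_presentation[OF assms(1)] assms(2) by (auto simp: relations_def kernel_def)

lemma eval_word_relator:
  fixes R :: "'x::finite word set"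
  assumes "R \<subseteq> carrier free_group" "w \<in> R"
  shows "eval_word (presentation R) (presentation_gen R) w = \<one>\<^bsub>presentation R\<^esub>"
  using assms subset_normal_closure[OF group_free_group assms(1)]
  by (subst eval_word_presentation_eq_one) auto

section \<open>Relations of G hold in G_n for large n\<close>

lemma relators_G_eventually:
  assumes "w \<in> relators_G"
  shows "\<forall>\<^sub>F n in sequentially. w \<in> normal_closure F3 (relators_G_seq n)"
proof -
  have closed: "w \<in> carrier F3" using assms relators_closed(2) by blast
  \<comment> \<open>In G_n the indices (0,j) and (i,k) become exponents j and n i + k of
    \<open>a\<close>, and i \<ge> 1 with j < n puts them in increasing order. The bound on
    \<open>n\<close> depends on j alone.\<close>
  have *: "w \<in> {R1, R2, commutator F3 wc wa} \<or> (\<exists>i j k. w = relator_ijk i j k \<and> 1 \<le> i \<and> j < n)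
      \<Longrightarrow> w \<in> normal_closure F3 (relators_G_seq n)" for n
  proof -
    assume w: "w \<in> {R1, R2, commutator F3 wc wa} \<or>
      (\<exists>i j k. w = relator_ijk i j k \<and> 1 \<le> i \<and> j < n)"
    let ?K = "presentation (relators_G_seq n)" and ?S = "presentation_gen (relators_G_seq n)"
    interpret K: three_gen ?K ?S
      by (rule three_gen_presentation[OF relators_closed(1)])
    interpret h: group_hom F3 ?K "eval_word ?K ?S"
      by (rule K.eval_hom)
    have rel: "eval_word ?K ?S v = \<one>\<^bsub>?K\<^esub>" if "v \<in> relators_G_seq n" for v
      using eval_word_relator[OF relators_closed(1) that] .
    have "inv\<^bsub>F3\<^esub> wc \<otimes>\<^bsub>F3\<^esub> wa [^]\<^bsub>F3\<^esub> n \<in> relators_G_seq n"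
      by (simp add: relators_G_seq_def)
    from rel[OF this] have "inv\<^bsub>?K\<^esub> K.c \<otimes>\<^bsub>?K\<^esub> K.a [^]\<^bsub>?K\<^esub> n = \<one>\<^bsub>?K\<^esub>"
      by (simp add: h.hom_nat_pow basis_elt_closed K.eval_basis_elt)
    then have c: "K.c = K.a [^]\<^bsub>?K\<^esub> n"
      using K.inv_solve_left'[of "\<one>\<^bsub>?K\<^esub>" "K.c" "K.a [^]\<^bsub>?K\<^esub> n"] by simp
    have comm: "K.a \<otimes>\<^bsub>?K\<^esub> K.c = K.c \<otimes>\<^bsub>?K\<^esub> K.a"
      unfolding c
      by (metis K.S_closed K.nat_pow_Suc K.nat_pow_Suc2)
    interpret K: commuting_gens ?K ?S
      by unfold_locales (rule comm)
    have X: "K.X (i, j) = K.X (0, int n * i + j)" for i j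
    proof -
      have "K.c [^]\<^bsub>?K\<^esub> i = K.a [^]\<^bsub>?K\<^esub> (int n * i)"
        unfolding c int_pow_int[symmetric] by (simp add: K.int_pow_pow)
      then show ?thesis
        by (simp add: translate_def K.int_pow_mult[symmetric] add.commute)
    qed
    have "eval_word ?K ?S R1 = \<one>\<^bsub>?K\<^esub> \<and> eval_word ?K ?S R2 = \<one>\<^bsub>?K\<^esub>"
      using rel by (simp add: relators_G_seq_def)
    then have F: "conj_by ?K (K.X (0, j)) (K.X (0, k)) = K.X (0, k + 1)" if "j < k" for j k
      using that K.thompson_relations K.eval_R1_eq_one_iff K.eval_R2_eq_one_iff by blast
    have "eval_word ?K ?S w = \<one>\<^bsub>?K\<^esub>"
      using w
    proof (elim disjE exE conjE)
      assume "w \<in> {R1, R2, commutator F3 wc wa}"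
      moreover have "eval_word ?K ?S (commutator F3 wc wa) = \<one>\<^bsub>?K\<^esub>"
        by (simp add: hom_commutator[OF K.eval_hom] basis_elt_closed K.eval_basis_elt
            K.commutator_eq_one_iff K.conj_by_eq_self_iff comm)
      ultimately show ?thesis using rel by (auto simp: relators_G_seq_def)
    next
      fix i j k
      assume w: "w = relator_ijk i j k" and "1 \<le> i" "j < n"
      then have "n \<le> n * i" by simp
      then have "j < n * i + k" using \<open>j < n\<close> by linarith
      then have "int j < int n * int i + int k"
        by (simp only: of_nat_less_iff of_nat_add[symmetric] of_nat_mult[symmetric])
      then show ?thesis
        unfolding w K.eval_relator_eq_one_iff
        using F by (simp add: X[of "int i"] add.assoc)
    qed
    then show ?thesis
      by (simp add: eval_word_presentation_eq_one[OF relators_closed(1) closed])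
  qed
  have "w \<in> {R1, R2, commutator F3 wc wa} \<or> (\<exists>i j k. w = relator_ijk i j k \<and> 1 \<le> i)"
    using assms unfolding relators_G_def by blast
  \<comment> \<open>For the three single relators any \<open>j\<close> will do.\<close>
  then obtain j where j: "\<And>n. j < n \<Longrightarrow>
      w \<in> {R1, R2, commutator F3 wc wa} \<or> (\<exists>i j k. w = relator_ijk i j k \<and> 1 \<le> i \<and> j < n)"
    by blast
  show ?thesis
    by (rule eventually_mono[OF eventually_gt_at_top[of j]]) (rule *[OF j])
qed

text \<open>The words that are trivial in G_n for all large \<open>n\<close> form a normal subgroup:
  products, inverses and conjugates involve finitely many such words, whose thresholds can be
  combined. It contains the relators of G.\<close>

lemma normal_closure_eventually:
  assumes "w \<in> normal_closure F3 relators_G"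
  shows "\<forall>\<^sub>F n in sequentially. w \<in> normal_closure F3 (relators_G_seq n)"
proof -
  let ?N = "\<lambda>n. normal_closure F3 (relators_G_seq n)"
  let ?E = "{w \<in> carrier F3. \<forall>\<^sub>F n in sequentially. w \<in> ?N n}"
  have N: "?N n \<lhd> F3" for n
    by (rule normal_normal_closure[OF group_free_group relators_closed(1)])
  have sub: "subgroup (?N n) F3" for n
    using N normal_imp_subgroup by blast
  have "subgroup ?E F3"
  proof
    show "\<one>\<^bsub>F3\<^esub> \<in> ?E" using subgroup.one_closed[OF sub] by simp
  next
    fix x y assume "x \<in> ?E" "y \<in> ?E"
    then show "x \<otimes>\<^bsub>F3\<^esub> y \<in> ?E"
      using subgroup.m_closed[OF sub] by (auto elim: eventually_elim2)
  next
    fix x assume "x \<in> ?E"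
    then show "inv\<^bsub>F3\<^esub> x \<in> ?E"
      using subgroup.m_inv_closed[OF sub] by (auto elim: eventually_mono)
  qed auto
  then have "?E \<lhd> F3"
    unfolding F3.normal_inv_iff using normal.inv_op_closed2[OF N]
    by (auto elim: eventually_mono)
  then have "normal_closure F3 relators_G \<subseteq> ?E"
    using relators_closed(2) relators_G_eventually by (intro normal_closure_subset) auto
  then show ?thesis using assms by blast
qed

section \<open>Words trivial in infinitely many G_n are trivial in G\<close>

lemma lex_group_presentation: "lex_group (presentation relators_G) (presentation_gen relators_G)"
proof -
  let ?K = "presentation relators_G" and ?S = "presentation_gen relators_G"
  interpret K: three_gen ?K ?S
    by (rule three_gen_presentation[OF relators_closed(2)])
  have rel: "eval_word ?K ?S v = \<one>\<^bsub>?K\<^esub>" if "v \<in> relators_G" for v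
    using eval_word_relator[OF relators_closed(2) that] .
  have "eval_word ?K ?S (commutator F3 wc wa) = \<one>\<^bsub>?K\<^esub>"
    by (rule rel) (simp add: relators_G_def)
  then have comm: "K.c \<otimes>\<^bsub>?K\<^esub> K.a = K.a \<otimes>\<^bsub>?K\<^esub> K.c"
    by (simp add: hom_commutator[OF K.eval_hom] basis_elt_closed K.eval_basis_elt
        K.commutator_eq_one_iff K.conj_by_eq_self_iff)
  interpret K: commuting_gens ?K ?S
    by unfold_locales (rule comm[symmetric])
  have "eval_word ?K ?S R1 = \<one>\<^bsub>?K\<^esub>" "eval_word ?K ?S R2 = \<one>\<^bsub>?K\<^esub>"
    by (rule rel, simp add: relators_G_def)+
  then have F: "conj_by ?K (K.X (i, j)) (K.X (i, k)) = K.X (i, k + 1)" if "j < k" for i j k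
    using that K.thompson_relations K.eval_R1_eq_one_iff K.eval_R2_eq_one_iff by blast
  show ?thesis
  proof
    fix q r assume lex: "lex_less q r"
    obtain i j i' k where q: "q = (i, j)" and r: "r = (i', k)" by (metis surj_pair)
    show "conj_by ?K (K.X q) (K.X r) = K.X (succ_index r)"
    proof (cases "i = i'")
      case True
      then show ?thesis using lex F by (simp add: q r succ_index_def lex_less_def)
    next
      case False
      \<comment> \<open>The relators cover only nonnegative exponents of \<open>a\<close> and start
        at row 0. Raising both exponents by \<open>m\<close> and lowering both rows by
        \<open>i\<close> reaches such a relator, and \<open>conj_X_X\<close> translates it
        back.\<close>
      define m where "m = \<bar>j\<bar> + \<bar>k\<bar>"
      have "0 \<le> j + m" "0 \<le> k + m" "0 \<le> i' - i" "i' - i \<noteq> 0"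
        using lex False by (auto simp: q r lex_less_def m_def)
      then obtain d j' k' :: nat where d: "i' - i = int d" "j + m = int j'" "k + m = int k'" "1 \<le> d"
        by (metis nonneg_int_cases of_nat_0 less_one not_le)
      have "relator_ijk d j' k' \<in> relators_G"
        using d(4) unfolding relators_G_def by blast
      then have "conj_by ?K (K.X (0, j + m)) (K.X (i' - i, k + m)) = K.X (i' - i, k + m + 1)"
        unfolding d by (simp only: rel K.eval_relator_eq_one_iff[symmetric])
      from K.conj_X_X[OF this, of i "- m"] show ?thesis
        by (simp add: q r succ_index_def)
    qed
  qed
qed

lemma normal_closure_frequently:
  assumes "w \<in> carrier F3" "\<exists>\<^sub>F n in sequentially. w \<in> normal_closure F3 (relators_G_seq n)"
  shows "w \<in> normal_closure F3 relators_G"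
proof -
  let ?K = "presentation relators_G" and ?S = "presentation_gen relators_G"
  let ?ev = "\<lambda>n. eval_word bij_group (line_action n)"
  interpret K: lex_group ?K ?S by (rule lex_group_presentation)
  interpret h: group_hom F3 ?K "eval_word ?K ?S" by (rule K.eval_hom)
  interpret e: group_hom F3 bij_group "?ev n" for n by (rule L.eval_hom)
  have line_trivial: "?ev n u = \<one>\<^bsub>bij_group\<^esub>" if "u \<in> normal_closure F3 (relators_G_seq n)" for u n
  proof -
    have "relations bij_group (line_action n) \<lhd> F3"
      unfolding relations_def by (rule e.normal_kernel)
    from normal_closure_subset[OF this line_action_relators] that show ?thesis
      by (auto simp: relations_def kernel_def)
  qed
  \<comment> \<open>Equality in G puts the quotient of the two words in the normal closure, so it is
    trivial in G_n, and therefore on the line, for all large \<open>n\<close>.\<close>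
  have transfer: "\<forall>\<^sub>F n in sequentially. ?ev n u = ?ev n v"
    if uv: "u \<in> carrier F3" "v \<in> carrier F3" "eval_word ?K ?S u = eval_word ?K ?S v" for u v
  proof -
    have "u \<otimes>\<^bsub>F3\<^esub> inv\<^bsub>F3\<^esub> v \<in> normal_closure F3 relators_G"
      using uv by (simp add: eval_word_presentation_eq_one[OF relators_closed(2), symmetric])
    from normal_closure_eventually[OF this] show ?thesis
    proof (rule eventually_mono)
      fix n assume "u \<otimes>\<^bsub>F3\<^esub> inv\<^bsub>F3\<^esub> v \<in> normal_closure F3 (relators_G_seq n)"
      then have "?ev n u \<otimes>\<^bsub>bij_group\<^esub> inv\<^bsub>bij_group\<^esub> ?ev n v = \<one>\<^bsub>bij_group\<^esub>"
        using line_trivial[of "u \<otimes>\<^bsub>F3\<^esub> inv\<^bsub>F3\<^esub> v" n] uv by simp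
      then show "?ev n u = ?ev n v"
        using uv L.inv_equality[of "?ev n u" "inv\<^bsub>bij_group\<^esub> ?ev n v"] by simp
    qed
  qed
  obtain m p :: int and ps qs where w: "eval_word ?K ?S w
      = K.a [^]\<^bsub>?K\<^esub> m \<otimes>\<^bsub>?K\<^esub> K.c [^]\<^bsub>?K\<^esub> p \<otimes>\<^bsub>?K\<^esub> (K.pos ps \<otimes>\<^bsub>?K\<^esub> inv\<^bsub>?K\<^esub> K.pos qs)"
    using K.eval_word_factorization by blast
  \<comment> \<open>The normal form of \<open>w\<close> in G is lifted to the free group, so that it
    too can be evaluated on the line.\<close>
  define u where "u = wa [^]\<^bsub>F3\<^esub> m \<otimes>\<^bsub>F3\<^esub> wc [^]\<^bsub>F3\<^esub> p \<otimes>\<^bsub>F3\<^esub> (F3.pos ps \<otimes>\<^bsub>F3\<^esub> inv\<^bsub>F3\<^esub> F3.pos qs)"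
  have "eval_word ?K ?S w = eval_word ?K ?S u"
    by (simp add: w u_def h.hom_int_pow K.eval_basis_elt K.eval_pos_word basis_elt_closed)
  moreover have u: "u \<in> carrier F3" by (simp add: u_def basis_elt_closed)
  ultimately have "\<forall>\<^sub>F n in sequentially. ?ev n w = ?ev n u"
    using assms(1) transfer by blast
  with assms(2) have "\<exists>\<^sub>F n in sequentially. w \<in> normal_closure F3 (relators_G_seq n) \<and> ?ev n w = ?ev n u"
    by (rule frequently_eventually_frequently)
  then have freq: "\<exists>\<^sub>F n in sequentially. height n (p, m) = 0 \<and> line_pos n ps = line_pos n qs"
  proof (rule frequently_elim1)
    fix n assume "w \<in> normal_closure F3 (relators_G_seq n) \<and> ?ev n w = ?ev n u"
    then have "?ev n u = \<one>\<^bsub>bij_group\<^esub>" using line_trivial by metis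
    moreover have "?ev n u = (\<lambda>t. t + of_int (height n (p, m))) \<otimes>\<^bsub>bij_group\<^esub>
        (line_pos n ps \<otimes>\<^bsub>bij_group\<^esub> inv\<^bsub>bij_group\<^esub> line_pos n qs)"
      by (simp add: u_def e.hom_int_pow L.eval_basis_elt L.eval_pos_word basis_elt_closed
          shifts_mult[symmetric] del: line_action.simps)
    moreover have shift: "(\<lambda>t::real. t + s) \<in> carrier bij_group" for s
      by (simp add: bij_group_def bij_shift)
    ultimately have "((\<lambda>t. t + of_int (height n (p, m))) \<otimes>\<^bsub>bij_group\<^esub> line_pos n ps)
        \<otimes>\<^bsub>bij_group\<^esub> inv\<^bsub>bij_group\<^esub> line_pos n qs = \<one>\<^bsub>bij_group\<^esub>"
      by (simp add: L.m_assoc)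
    then have "(\<lambda>t. t + of_int (height n (p, m))) \<otimes>\<^bsub>bij_group\<^esub> line_pos n ps = line_pos n qs"
      using shift L.inv_equality[of _ "inv\<^bsub>bij_group\<^esub> line_pos n qs"] by fastforce
    then have eq: "line_pos n ps t + of_int (height n (p, m)) = line_pos n qs t" for t
      by (auto simp: bij_group_def fun_eq_iff)
    \<comment> \<open>At a point fixed by both positive parts only the translation remains, so its
      length is 0.\<close>
    obtain t where "line_pos n ps t = t" "line_pos n qs t = t"
      using line_pos_eq_eventually by blast
    then have "height n (p, m) = 0" using eq[of t] by simp
    then show "height n (p, m) = 0 \<and> line_pos n ps = line_pos n qs" using eq by (auto simp: fun_eq_iff)
  qed
  \<comment> \<open>The zero translation is read as the height of (0, 0), so that two indices are
    compared.\<close>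
  then have "\<exists>\<^sub>F n in sequentially. height n (p, m) = height n (0, 0)"
    by (rule frequently_elim1) (simp add: height_def)
  then have "(p, m) = (0, 0)" by (rule frequently_height_eq)
  moreover have "K.pos ps = K.pos qs"
  proof (rule K.pos_eqI)
    fix ps qs assume "K.pos ps = K.pos qs"
    then show "\<forall>\<^sub>F n in sequentially. line_pos n ps = line_pos n qs"
      using transfer[of "F3.pos ps" "F3.pos qs"] by (simp add: K.eval_pos_word L.eval_pos_word)
  next
    show "\<exists>\<^sub>F n in sequentially. line_pos n ps = line_pos n qs"
      using freq by (rule frequently_elim1) simp
  qed
  ultimately have "eval_word ?K ?S w = \<one>\<^bsub>?K\<^esub>" by (simp add: w)
  then show ?thesis
    by (simp add: eval_word_presentation_eq_one[OF relators_closed(2) assms(1)])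
qed

text \<open>A ball around the limit is governed by words of bounded length. There are finitely many
  of them over a finite basis, so the thresholds for the single words have a common bound.\<close>

lemma limitin_presented_class:
  fixes R :: "nat \<Rightarrow> 'x::finite word set"
  assumes R: "\<And>n. R n \<subseteq> carrier free_group" and Q: "Q \<subseteq> carrier free_group"
    and conv: "\<And>w. w \<in> carrier free_group \<Longrightarrow> \<forall>\<^sub>F n in sequentially.
      w \<in> normal_closure free_group (R n) \<longleftrightarrow> w \<in> normal_closure free_group Q"
  shows "limitin marked_topology (\<lambda>n. presented_class (R n)) (presented_class Q) sequentially"
proof -
  interpret M: Metric_space "marked_space :: ('x, 'x word set) marked_class set" marked_dist
    by (rule Metric_space_marked)
  have space: "presented_class P \<in> marked_space" if "P \<subseteq> carrier free_group" for P :: "'x word set"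
    using marked_group_presentation[OF that] by (auto simp: presented_class_def marked_space_def)
  have close: "\<forall>\<^sub>F n in sequentially. marked_dist (presented_class (R n)) (presented_class Q) < \<epsilon>"
    if "\<epsilon> > 0" for \<epsilon> :: real
  proof -
    obtain N where N: "exp (- real N) < \<epsilon>"
    proof -
      obtain N where "- ln \<epsilon> < real N" using reals_Archimedean2 by blast
      then have "exp (- real N) < exp (ln \<epsilon>)" by simp
      then show ?thesis using that \<open>\<epsilon> > 0\<close> by simp
    qed
    let ?W = "{w :: 'x word. w \<in> carrier free_group \<and> length w \<le> N}"
    have "finite ?W"
      by (rule finite_subset[OF _ finite_lists_length_le[of UNIV N]]) auto
    then have "\<forall>\<^sub>F n in sequentially. \<forall>w\<in>?W.
        w \<in> normal_closure free_group (R n) \<longleftrightarrow> w \<in> normal_closure free_group Q"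
      using conv by (intro eventually_ball_finite) auto
    then show ?thesis
    proof (rule eventually_mono)
      fix n assume "\<forall>w\<in>?W. w \<in> normal_closure free_group (R n) \<longleftrightarrow> w \<in> normal_closure free_group Q"
      then have "same_relations N (presentation (R n)) (presentation_gen (R n))
          (presentation Q) (presentation_gen Q)"
        by (auto simp: same_relations_def relations_presentation R Q)
      then have "marked_dist (presented_class (R n)) (presented_class Q) \<le> exp (- real N)"
        unfolding presented_class_def
        using marked_dist_le_iff marked_group_presentation R Q by blast
      then show "marked_dist (presented_class (R n)) (presented_class Q) < \<epsilon>"
        using N by simp
    qed
  qed
  show ?thesis
    unfolding marked_topology_def M.limitin_metric
    using space R Q close by auto
qed

theorem theorem4p5:
  shows "limitin marked_topology (\<lambda>n. presented_class (relators_G_seq (Suc n)))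
           (presented_class relators_G) sequentially"
proof (rule limitin_presented_class[OF relators_closed(1) relators_closed(2)])
  fix w :: "gen3 word" assume w: "w \<in> carrier F3"
  have "\<forall>\<^sub>F n in sequentially.
      w \<in> normal_closure F3 (relators_G_seq n) \<longleftrightarrow> w \<in> normal_closure F3 relators_G"
  proof (cases "w \<in> normal_closure F3 relators_G")
    case True
    then show ?thesis using normal_closure_eventually by simp
  next
    case False
    then show ?thesis
      using normal_closure_frequently[OF w] by (auto simp: frequently_def)
  qed
  \<comment> \<open>The sequence starts with G_1, whence \<open>Suc n\<close>; a shift by one does
    not affect eventual statements.\<close>
  then show "\<forall>\<^sub>F n in sequentially.
      w \<in> normal_closure F3 (relators_G_seq (Suc n)) \<longleftrightarrow> w \<in> normal_closure F3 relators_G"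
    by (rule eventually_sequentially_Suc[THEN iffD2])
qed

end
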